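(* For every prime power $q>2$ there exists a strongly Deza graph with parameters $(q^2(q^2-q+1),\,q(q-1),\,1,\,0)$ whose spectrum consists of $q(q-1)$ with multiplicity $1$, $q$ with multiplicity $(q^4-q)/2-q^3+q^2$, $-1$ with multiplicity $q^3$, and $-q$ with multiplicity $(q^4-q)/2-q^3+q-1$. Moreover, its child $G_A$ is a strongly regular graph with parameters $(q^2(q^2-q+1),\,(q-1)(q+1)^2,\,2q^2-2,\,(q+1)^2)$.
   Context: All graphs are finite, simple and undirected; eigenvalues of a graph are those of its adjacency matrix. A Deza graph with parameters $(n,k,b,a)$, where $b\geqslant a$, is a $k$-regular graph on $n$ vertices, which is neither complete nor edgeless, such that any two distinct vertices have exactly $b$ or exactly $a$ common neighbours. If $b>a$, the children $G_A$ and $G_B$ of $G$ are the graphs on the vertex set of $G$ in which two distinct vertices are adjacent if and only if they have exactly $a$ (for $G_A$), respectively exactly $b$ (for $G_B$), common neighbours in $G$; if $b=a$, $G_A$ is the complete graph and $G_B$ is the edgeless graph. A strongly regular graph with parameters $(n,k,\lambda,\mu)$ is a $k$-regular graph on $n$ vertices, neither complete nor edgeless, in which any two adjacent vertices have exactly $\lambda$ common neighbours and any two distinct non-adjacent vertices have exactly $\mu$ common neighbours (disconnected examples, i.e. disjoint unions of at least two cliques of equal size, are allowed). A strongly Deza graph is a Deza graph both of whose children are strongly regular graphs. *)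

theory Defs
  imports "Jordan_Normal_Form.Char_Poly" "HOL-Number_Theory.Prime_Powers"
begin

definition simple_graph :: "nat \<Rightarrow> (nat \<Rightarrow> nat \<Rightarrow> bool) \<Rightarrow> bool" where
  "simple_graph n E \<longleftrightarrow>
     (\<forall>x y. E x y \<longrightarrow> x < n \<and> y < n) \<and>
     (\<forall>x. \<not> E x x) \<and> (\<forall>x y. E x y \<longrightarrow> E y x)"

definition common_nbrs :: "nat \<Rightarrow> (nat \<Rightarrow> nat \<Rightarrow> bool) \<Rightarrow> nat \<Rightarrow> nat \<Rightarrow> nat" where
  "common_nbrs n E x y = card {z. z < n \<and> E x z \<and> E y z}"

definition regular_graph :: "nat \<Rightarrow> (nat \<Rightarrow> nat \<Rightarrow> bool) \<Rightarrow> nat \<Rightarrow> bool" where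
  "regular_graph n E k \<longleftrightarrow> simple_graph n E \<and> (\<forall>x<n. card {y. y < n \<and> E x y} = k)"

definition complete_graph :: "nat \<Rightarrow> (nat \<Rightarrow> nat \<Rightarrow> bool) \<Rightarrow> bool" where
  "complete_graph n E \<longleftrightarrow> (\<forall>x<n. \<forall>y<n. x \<noteq> y \<longrightarrow> E x y)"

definition edgeless_graph :: "nat \<Rightarrow> (nat \<Rightarrow> nat \<Rightarrow> bool) \<Rightarrow> bool" where
  "edgeless_graph n E \<longleftrightarrow> (\<forall>x<n. \<forall>y<n. \<not> E x y)"

definition deza_graph :: "nat \<Rightarrow> (nat \<Rightarrow> nat \<Rightarrow> bool) \<Rightarrow> nat \<Rightarrow> nat \<Rightarrow> nat \<Rightarrow> bool" where
  "deza_graph n E k b a \<longleftrightarrow> regular_graph n E k \<and> b \<ge> a \<and>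
     \<not> complete_graph n E \<and> \<not> edgeless_graph n E \<and>
     (\<forall>x<n. \<forall>y<n. x \<noteq> y \<longrightarrow> common_nbrs n E x y = a \<or> common_nbrs n E x y = b)"

definition srg :: "nat \<Rightarrow> (nat \<Rightarrow> nat \<Rightarrow> bool) \<Rightarrow> nat \<Rightarrow> nat \<Rightarrow> nat \<Rightarrow> bool" where
  "srg n E k lam mu \<longleftrightarrow> regular_graph n E k \<and>
     \<not> complete_graph n E \<and> \<not> edgeless_graph n E \<and>
     (\<forall>x<n. \<forall>y<n. x \<noteq> y \<longrightarrow> E x y \<longrightarrow> common_nbrs n E x y = lam) \<and>
     (\<forall>x<n. \<forall>y<n. x \<noteq> y \<longrightarrow> \<not> E x y \<longrightarrow> common_nbrs n E x y = mu)"

definition is_srg :: "nat \<Rightarrow> (nat \<Rightarrow> nat \<Rightarrow> bool) \<Rightarrow> bool" where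
  "is_srg n E \<longleftrightarrow> (\<exists>k lam mu. srg n E k lam mu)"

definition childA :: "nat \<Rightarrow> (nat \<Rightarrow> nat \<Rightarrow> bool) \<Rightarrow> nat \<Rightarrow> nat \<Rightarrow> nat \<Rightarrow> nat \<Rightarrow> bool" where
  "childA n E b a x y \<longleftrightarrow> x < n \<and> y < n \<and> x \<noteq> y \<and>
     (if b > a then common_nbrs n E x y = a else True)"

definition childB :: "nat \<Rightarrow> (nat \<Rightarrow> nat \<Rightarrow> bool) \<Rightarrow> nat \<Rightarrow> nat \<Rightarrow> nat \<Rightarrow> nat \<Rightarrow> bool" where
  "childB n E b a x y \<longleftrightarrow> x < n \<and> y < n \<and> x \<noteq> y \<and>
     (if b > a then common_nbrs n E x y = b else False)"

definition strongly_deza :: "nat \<Rightarrow> (nat \<Rightarrow> nat \<Rightarrow> bool) \<Rightarrow> nat \<Rightarrow> nat \<Rightarrow> nat \<Rightarrow> bool" where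
  "strongly_deza n E k b a \<longleftrightarrow> deza_graph n E k b a \<and>
     is_srg n (childA n E b a) \<and> is_srg n (childB n E b a)"

definition adj_matrix :: "nat \<Rightarrow> (nat \<Rightarrow> nat \<Rightarrow> bool) \<Rightarrow> real mat" where
  "adj_matrix n E = mat n n (\<lambda>(i, j). if E i j then 1 else 0)"

end

theory Submission
  imports "HOL-Algebra.Multiplicative_Group" "HOL-Algebra.Algebraic_Closure"
    "HOL-Number_Theory.Residues" Defs "Jordan_Normal_Form.Schur_Decomposition"
begin

text \<open>The graph is the orthogonality graph on the non-isotropic points of the projective plane over
  $GF(q^2)$ with a nondegenerate Hermitian form. The counts that enter the proof need only the unitary
  polarity: two points have exactly one common perpendicular point, an absolute point is
  perpendicular to no other absolute point, and a non-absolute point is perpendicular to exactly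
  $q + 1$ absolute points. Counting two-step walks gives $A^3 + A^2 = q^2 A + q^2 I + (q^2 - 2q) J$
  for the adjacency matrix $A$. Hence $A^4$ is a combination of $A^2$, $I$ and $J$, so the
  adjacency matrices of both children, which are combinations of $A^2$, $I$ and $J$ as well, have
  squares that are combinations of themselves, $I$ and $J$: the children are strongly regular.
  The same relation confines the spectrum to $k, q, -1, -q$, and the traces of
  $I, A, A^2, A^3$ then fix the multiplicities.\<close>

section \<open>Finite fields\<close>

text \<open>The cubic relation rests on one bijection: for nonperpendicular points x and y, sending
  a point z of the polar line of x to the common perpendicular of y and z maps that line onto the
  polar line of y, so inclusion-exclusion over absolute points does the counting. Multiplying the
  relation by A and using it once more cancels the linear term; this is why A^4 is free of A. On
  vectors with coordinate sum 0 the relation reads (A + I)(A - qI)(A + qI) = 0, the source of the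
  eigenvalues q, -1, -q; the all-ones direction gives k. The hypothesis q > 2 separates k = q(q - 1)
  from q, which coincide for q = 2. The plane needs a field of order q^2 with an involution. It is
  cut out of the algebraic closure of Z/p as the set of x with x^(q^2) = x, which has the right size
  because X^(q^2) - X has only simple roots. Conjugation is x -> x^q, and the fibre sizes of its
  norm and trace yield the number q + 1 of absolute points on a secant line.\<close>

lemma (in cring) binomial_theorem:
  assumes x: "x \<in> carrier R" and y: "y \<in> carrier R"
  shows "(x \<oplus> y) [^] n = finsum R (\<lambda>i. [(n choose i)] \<cdot> (x [^] i \<otimes> y [^] (n - i))) {..n}"
proof (induction n)
  case 0
  show ?case using x y by simp
next
  case (Suc n)
  define t where "t m i = x [^] i \<otimes> y [^] (m - i)" for m i :: nat
  have tc: "t m i \<in> carrier R" for m i using x y by (simp add: t_def)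
  have tc': "[c] \<cdot> t m i \<in> carrier R" for m i and c :: nat using tc by simp
  have tx: "t n i \<otimes> x = t (Suc n) (Suc i)" for i
    using x y by (simp add: t_def m_ac)
  have ty: "t n i \<otimes> y = t (Suc n) i" if "i \<le> n" for i
    using x y that by (simp add: t_def m_ac Suc_diff_le)
  let ?S = "\<lambda>f. finsum R f {..n}"
  have IH: "(x \<oplus> y) [^] n = ?S (\<lambda>i. [(n choose i)] \<cdot> t n i)"
    using Suc.IH by (simp add: t_def)
  have "(x \<oplus> y) [^] Suc n = ?S (\<lambda>i. [(n choose i)] \<cdot> t n i) \<otimes> x \<oplus> ?S (\<lambda>i. [(n choose i)] \<cdot> t n i) \<otimes> y"
    using x y tc' by (simp add: IH r_distr)
  also have "?S (\<lambda>i. [(n choose i)] \<cdot> t n i) \<otimes> x = ?S (\<lambda>i. [(n choose i)] \<cdot> t (Suc n) (Suc i))"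
    using x tc tc' by (simp add: finsum_ldistr add_pow_ldistr tx cong: finsum_cong)
  also have "?S (\<lambda>i. [(n choose i)] \<cdot> t n i) \<otimes> y = ?S (\<lambda>i. [(n choose i)] \<cdot> t (Suc n) i)"
    using y tc tc' by (subst finsum_ldistr) (auto simp: add_pow_ldistr ty intro!: finsum_cong')
  also have "\<dots> = finsum R (\<lambda>i. [(n choose i)] \<cdot> t (Suc n) i) {..Suc n}"
    using tc' by (subst finsum_Suc) (auto simp: binomial_eq_0)
  also have "\<dots> = ?S (\<lambda>i. [(n choose Suc i)] \<cdot> t (Suc n) (Suc i)) \<oplus> t (Suc n) 0"
    using tc' tc by (subst finsum_Suc2) auto
  also have "?S (\<lambda>i. [(n choose i)] \<cdot> t (Suc n) (Suc i)) \<oplus>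
      (?S (\<lambda>i. [(n choose Suc i)] \<cdot> t (Suc n) (Suc i)) \<oplus> t (Suc n) 0) =
      ?S (\<lambda>i. [(Suc n choose Suc i)] \<cdot> t (Suc n) (Suc i)) \<oplus> t (Suc n) 0"
    using tc tc' by (simp add: a_assoc[symmetric] finsum_addf[symmetric] add.nat_pow_mult)
  also have "\<dots> = finsum R (\<lambda>i. [(Suc n choose i)] \<cdot> t (Suc n) i) {..Suc n}"
    using tc' tc by (subst finsum_Suc2) auto
  finally show ?case by (simp add: t_def)
qed

lemma (in cring) add_pow_char_multiple:
  fixes p m :: nat
  assumes "[p] \<cdot> \<one> = \<zero>" and "p dvd m" and "x \<in> carrier R"
  shows "[m] \<cdot> x = \<zero>"
proof -
  obtain k where m: "m = p * k" using assms(2) by (auto simp: dvd_def)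
  have "[p] \<cdot> x = ([p] \<cdot> \<one>) \<otimes> x" using add_pow_ldistr[OF one_closed assms(3), of p] assms(3) by simp
  then have "[p] \<cdot> x = \<zero>" using assms by simp
  then show ?thesis unfolding m using assms(3) by (simp add: add.nat_pow_pow[symmetric])
qed

text \<open>The inner binomial coefficients are divisible by \<open>p\<close>, so only the two end
  terms of the expansion survive.\<close>

lemma (in cring) frobenius_add_prime:
  assumes p: "prime (p::nat)" and ch: "[p] \<cdot> \<one> = \<zero>"
    and x: "x \<in> carrier R" and y: "y \<in> carrier R"
  shows "(x \<oplus> y) [^] p = x [^] p \<oplus> y [^] p"
proof -
  obtain m where m: "p = Suc m" using prime_gt_0_nat[OF p] by (cases p) auto
  obtain l where l: "m = Suc l" using prime_gt_1_nat[OF p] m by (cases m) auto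
  define t where "t i = [(p choose i)] \<cdot> (x [^] i \<otimes> y [^] (p - i))" for i :: nat
  have tc: "t i \<in> carrier R" for i using x y by (simp add: t_def)
  have z: "t (Suc i) = \<zero>" if "i \<le> l" for i
    unfolding t_def using x y
    by (intro add_pow_char_multiple[OF ch] dvd_choose_prime) (use that p m l in auto)
  have "(x \<oplus> y) [^] p = finsum R t {..p}"
    unfolding t_def by (rule binomial_theorem[OF x y])
  also have "\<dots> = t p \<oplus> finsum R t {..m}"
    unfolding m using tc by (subst finsum_Suc) (auto simp: a_comm)
  also have "finsum R t {..m} = finsum R (\<lambda>i. t (Suc i)) {..l} \<oplus> t 0"
    unfolding l using tc by (subst finsum_Suc2) auto
  also have "finsum R (\<lambda>i. t (Suc i)) {..l} = finsum R (\<lambda>i. \<zero>) {..l}"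
    using z by (intro finsum_cong') auto
  finally show ?thesis using x y tc by (simp add: t_def)
qed

lemma (in cring) frobenius_add:
  assumes p: "prime (p::nat)" and ch: "[p] \<cdot> \<one> = \<zero>"
    and x: "x \<in> carrier R" and y: "y \<in> carrier R"
  shows "(x \<oplus> y) [^] (p ^ m) = x [^] (p ^ m) \<oplus> y [^] (p ^ m)"
proof (induction m)
  case 0
  show ?case using x y by simp
next
  case (Suc m)
  have e: "z [^] (p ^ Suc m) = (z [^] (p ^ m)) [^] p" if "z \<in> carrier R" for z
    using that by (simp add: nat_pow_pow mult.commute)
  show ?case using x y by (simp only: e a_closed Suc frobenius_add_prime[OF p ch] nat_pow_closed)
qed

text \<open>Additivity is applied to -x + x = 0, which avoids a case split on the parity of
  \<open>p\<close>.\<close>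

lemma (in cring) frobenius_minus:
  assumes p: "prime (p::nat)" and ch: "[p] \<cdot> \<one> = \<zero>" and x: "x \<in> carrier R"
  shows "(\<ominus> x) [^] (p ^ m) = \<ominus> (x [^] (p ^ m))"
proof -
  have "(\<ominus> x) [^] (p ^ m) \<oplus> x [^] (p ^ m) = \<zero>"
    using frobenius_add[OF p ch, of "\<ominus> x" x m] x p
    by (simp add: l_neg nat_pow_zero prime_gt_0_nat)
  then show ?thesis using x by (simp add: minus_equality)
qed

text \<open>The polynomial ring inherits characteristic \<open>p\<close>, so (X - a)^Q = X^Q - a^Q =
  X^Q - a for Q = p^m, and the two constants cancel.\<close>

lemma (in domain) root_factor_frobenius:
  fixes p m :: nat
  assumes p: "prime p" and ch: "[p] \<cdot> \<one> = \<zero>" and a: "a \<in> carrier R"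
    and fix_a: "a [^] (p ^ m) = a"
  shows "[\<one>, \<ominus> a] [^]\<^bsub>poly_ring R\<^esub> (p ^ m) \<ominus>\<^bsub>poly_ring R\<^esub> [\<one>, \<ominus> a]
    = X [^]\<^bsub>poly_ring R\<^esub> (p ^ m) \<ominus>\<^bsub>poly_ring R\<^esub> X"
proof -
  interpret UP: domain "poly_ring R"
    using univ_poly_is_domain[OF carrier_is_subring] .
  interpret C: ring_hom_ring R "poly_ring R" poly_of_const
    using canonical_embedding_ring_hom[OF carrier_is_subring] by simp
  define A where "A = poly_of_const a"
  have A: "A \<in> carrier (poly_ring R)" using a by (simp add: A_def)
  have X: "X \<in> carrier (poly_ring R)" using var_closed[OF carrier_is_subring] by simp
  have "poly_of_const ([k] \<cdot> \<one>) = [k] \<cdot>\<^bsub>poly_ring R\<^esub> \<one>\<^bsub>poly_ring R\<^esub>" for k :: nat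
    by (induction k) auto
  then have chU: "[p] \<cdot>\<^bsub>poly_ring R\<^esub> \<one>\<^bsub>poly_ring R\<^esub> = \<zero>\<^bsub>poly_ring R\<^esub>"
    using ch by (metis C.hom_zero)
  have XA: "[\<one>, \<ominus> a] = X \<oplus>\<^bsub>poly_ring R\<^esub> (\<ominus>\<^bsub>poly_ring R\<^esub> A)"
    using A a univ_poly_a_inv_def'[OF carrier_is_subring A]
    by (auto simp: A_def poly_of_const_def univ_poly_add var_def)
  have "A [^]\<^bsub>poly_ring R\<^esub> (p ^ m) = A"
    unfolding A_def using C.hom_nat_pow[OF a, of "p ^ m"] fix_a by simp
  then have "(X \<oplus>\<^bsub>poly_ring R\<^esub> (\<ominus>\<^bsub>poly_ring R\<^esub> A)) [^]\<^bsub>poly_ring R\<^esub> (p ^ m)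
     = X [^]\<^bsub>poly_ring R\<^esub> (p ^ m) \<oplus>\<^bsub>poly_ring R\<^esub> (\<ominus>\<^bsub>poly_ring R\<^esub> A)"
    using UP.frobenius_add[OF p chU X, of "\<ominus>\<^bsub>poly_ring R\<^esub> A" m]
      UP.frobenius_minus[OF p chU A, of m] A by simp
  then show ?thesis unfolding XA
    using A X UP.nat_pow_closed[OF X, of "p ^ m"]
    by (simp add: UP.minus_eq UP.minus_add UP.a_ac UP.r_neg1 UP.r_neg2)
qed

text \<open>If $a$ is a root, then $X^Q - X = (X - a)((X - a)^{Q - 1} - 1)$ for $Q = p^m$, and the second
  factor takes the value $-1$ at $a$.\<close>

lemma (in domain) simple_root_frobenius:
  fixes p m :: nat
  assumes p: "prime p" and ch: "[p] \<cdot> \<one> = \<zero>" and m: "m > 0"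
    and a: "a \<in> carrier R" and fix_a: "a [^] (p ^ m) = a"
    and f: "f = X [^]\<^bsub>poly_ring R\<^esub> (p ^ m) \<ominus>\<^bsub>poly_ring R\<^esub> X"
  shows "alg_mult f a \<le> 1"
proof (rule ccontr)
  interpret UP: domain "poly_ring R"
    using univ_poly_is_domain[OF carrier_is_subring] .
  interpret E: ring_hom_ring "poly_ring R" R "\<lambda>p. eval p a"
    using eval_ring_hom[OF carrier_is_subring a] .
  have X: "X \<in> carrier (poly_ring R)" using var_closed[OF carrier_is_subring] by simp
  have fc: "f \<in> carrier (poly_ring R)" using X by (simp add: f)
  define c where "c = [\<one>, \<ominus> a]"
  have c: "c \<in> carrier (poly_ring R)"
    using a unfolding c_def univ_poly_carrier[symmetric] polynomial_def by auto
  have c0: "c \<noteq> \<zero>\<^bsub>poly_ring R\<^esub>" by (simp add: c_def univ_poly_zero)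
  have ec: "eval c a = \<zero>" using a by (simp add: c_def r_neg)
  assume "\<not> alg_mult f a \<le> 1"
  then have "(c [^]\<^bsub>poly_ring R\<^esub> (2::nat)) pdivides f"
    unfolding c_def by (intro le_alg_mult_imp_pdivides[OF a fc]) simp
  then obtain g where g: "g \<in> carrier (poly_ring R)"
    and fg: "f = c [^]\<^bsub>poly_ring R\<^esub> (2::nat) \<otimes>\<^bsub>poly_ring R\<^esub> g"
    unfolding pdivides_def factor_def by blast
  define Q where "Q = p ^ m"
  have Q: "Q > 1" unfolding Q_def using prime_gt_1_nat[OF p] m by (rule one_less_power)
  then obtain l where l: "Q = Suc (Suc l)" by (intro that[of "Q - 2"]) simp
  let ?h = "c [^]\<^bsub>poly_ring R\<^esub> (Suc l) \<ominus>\<^bsub>poly_ring R\<^esub> \<one>\<^bsub>poly_ring R\<^esub>"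
  have cl: "c [^]\<^bsub>poly_ring R\<^esub> Suc l \<in> carrier (poly_ring R)" by (rule UP.nat_pow_closed[OF c])
  have "c \<otimes>\<^bsub>poly_ring R\<^esub> ?h = c \<otimes>\<^bsub>poly_ring R\<^esub> c [^]\<^bsub>poly_ring R\<^esub> Suc l
      \<oplus>\<^bsub>poly_ring R\<^esub> c \<otimes>\<^bsub>poly_ring R\<^esub> (\<ominus>\<^bsub>poly_ring R\<^esub> \<one>\<^bsub>poly_ring R\<^esub>)"
    unfolding UP.minus_eq by (rule UP.r_distr[OF cl _ c]) simp
  also have "\<dots> = c [^]\<^bsub>poly_ring R\<^esub> Q \<ominus>\<^bsub>poly_ring R\<^esub> c"
    unfolding UP.minus_eq l UP.nat_pow_Suc2[OF c, of "Suc l"] UP.r_minus[OF c UP.one_closed]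
      UP.r_one[OF c] ..
  also have "\<dots> = f" unfolding f Q_def c_def by (rule root_factor_frobenius[OF p ch a fix_a])
  also have "\<dots> = c \<otimes>\<^bsub>poly_ring R\<^esub> (c \<otimes>\<^bsub>poly_ring R\<^esub> g)"
    using c g by (simp add: fg numeral_2_eq_2 UP.m_assoc)
  finally have "?h = c \<otimes>\<^bsub>poly_ring R\<^esub> g"
    using UP.m_lcancel[OF c0 c] c g by simp
  then have "eval ?h a = eval (c \<otimes>\<^bsub>poly_ring R\<^esub> g) a" by simp
  then have "\<zero> \<otimes> eval g a = \<zero> \<ominus> \<one>"
    using c g ec by (simp add: UP.minus_eq minus_eq del: UP.nat_pow_Suc)
  then have "\<ominus> \<one> = \<zero>" using E.hom_closed[OF g] by (simp add: minus_eq)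
  then show False by (metis one_closed one_not_zero r_neg r_zero)
qed

text \<open>The fixed points are the roots of X^Q - X, which splits here and has only simple roots;
  hence there are as many as its degree.\<close>

lemma (in algebraically_closed) card_frobenius_fixed:
  fixes p m :: nat
  assumes p: "prime p" and ch: "[p] \<cdot> \<one> = \<zero>" and m: "m > 0"
  shows "card {x \<in> carrier L. x [^] (p ^ m) = x} = p ^ m"
    and "finite {x \<in> carrier L. x [^] (p ^ m) = x}"
proof -
  interpret UP: domain "poly_ring L"
    using univ_poly_is_domain[OF carrier_is_subring] .
  define f where "f = X [^]\<^bsub>poly_ring L\<^esub> (p ^ m) \<ominus>\<^bsub>poly_ring L\<^esub> X"
  let ?S = "{x \<in> carrier L. x [^] (p ^ m) = x}"
  have X: "X \<in> carrier (poly_ring L)" using var_closed[OF carrier_is_subring] by simp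
  have fc: "f \<in> carrier (poly_ring L)" using X by (simp add: f_def)
  have Q: "p ^ m > 1" using prime_gt_1_nat[OF p] m by (rule one_less_power)
  have pm: "polynomial (carrier L) (monom \<one> (p ^ m))"
    using monom_is_polynomial[OF carrier_is_subring] by simp
  have mX: "\<ominus>\<^bsub>poly_ring L\<^esub> X = [\<ominus> \<one>, \<zero>]"
    using univ_poly_a_inv_def'[OF carrier_is_subring X] by (simp add: var_def)
  have pX: "polynomial (carrier L) [\<ominus> \<one>, \<zero>]"
    using UP.a_inv_closed[OF X] unfolding mX univ_poly_carrier .
  have f_eq: "f = poly_add (monom \<one> (p ^ m)) [\<ominus> \<one>, \<zero>]"
    unfolding f_def UP.minus_eq mX univ_poly_add
      unitary_monom_eq_var_pow[OF carrier_is_subring] ..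
  \<comment> \<open>As Q > 1, the summand -X has smaller degree and leaves the leading term
    alone.\<close>
  have deg: "length f - 1 = p ^ m"
    unfolding f_eq using Q m
    by (subst poly_add_degree_eq[OF carrier_is_subring pm pX]) (auto simp: monom_def)
  then have f0: "f \<noteq> []" using p by auto
  have ev: "eval f a = a [^] (p ^ m) \<ominus> a" if a: "a \<in> carrier L" for a
  proof -
    interpret E: ring_hom_ring "poly_ring L" L "\<lambda>p. eval p a"
      using eval_ring_hom[OF carrier_is_subring a] .
    show ?thesis unfolding f_def
      using X a by (simp add: UP.minus_eq minus_eq E.hom_nat_pow eval_var)
  qed
  have root: "x \<in># roots f \<longleftrightarrow> x \<in> ?S" for x
    using f0 by (auto simp: ev roots_mem_iff_is_root[OF fc] is_root_def)
  then have set_eq: "set_mset (roots f) = ?S" by blast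
  have "count (roots f) x = 1" if "x \<in> ?S" for x
  proof -
    have "count (roots f) x \<le> 1"
      using simple_root_frobenius[OF p ch m _ _ f_def] that
      by (auto simp flip: alg_mult_eq_count_roots[OF fc])
    moreover have "count (roots f) x > 0" using root[of x] that by (simp add: count_greater_zero_iff)
    ultimately show ?thesis by linarith
  qed
  then have "size (roots f) = card ?S"
    unfolding size_multiset_overloaded_eq set_eq by simp
  moreover have "size (roots f) = length f - 1"
    using roots_over_carrier[OF fc] unfolding splitted_def .
  ultimately show "card ?S = p ^ m" using deg by simp
  show "finite ?S" unfolding set_eq[symmetric] by simp
qed

text \<open>Fixed points of a ring endomorphism; for inverses, the power of \<open>inv k\<close> is
  again an inverse of \<open>k\<close>.\<close>

lemma (in field) subfield_frobenius_fixed: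
  fixes p m :: nat
  assumes p: "prime p" and ch: "[p] \<cdot> \<one> = \<zero>"
  shows "subfield {x \<in> carrier R. x [^] (p ^ m) = x} R"
proof (rule subfieldI'[OF subringI])
  have "p ^ m \<noteq> 0" using p by auto
  fix k assume k: "k \<in> {x \<in> carrier R. x [^] (p ^ m) = x} - {\<zero>}"
  then have u: "k \<in> Units R" by (simp add: field_Units)
  then have "inv k [^] (p ^ m) \<otimes> k [^] (p ^ m) = \<one>"
    using nat_pow_distrib[of "inv k" k "p ^ m"] Units_closed[OF u] by simp
  then show "inv k \<in> {x \<in> carrier R. x [^] (p ^ m) = x}"
    using k u inv_unique'[of k "inv k [^] (p ^ m)"] by (auto simp: m_comm)
qed (auto simp: frobenius_add[OF p ch] frobenius_minus[OF p ch] nat_pow_distrib)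

text \<open>The type is that of the algebraic closure of a residue ring over the integers. The
  characteristic and the identity x^Q = x are exported because additivity and involutivity of the
  conjugation rest on them.\<close>

theorem finite_field_exists:
  fixes p m :: nat
  assumes p: "prime p" and m: "m > 0"
  shows "\<exists>F :: ((int list \<times> nat) multiset \<Rightarrow> int) ring.
    field F \<and> finite (carrier F) \<and> card (carrier F) = p ^ m \<and>
    [p] \<cdot>\<^bsub>F\<^esub> \<one>\<^bsub>F\<^esub> = \<zero>\<^bsub>F\<^esub> \<and> (\<forall>x\<in>carrier F. x [^]\<^bsub>F\<^esub> (p ^ m) = x)"
proof -
  define R where "R = residue_ring (int p)"
  interpret R: residues_prime p R
    unfolding R_def by (rule residues_prime.intro[OF p])
  define L where "L = R.alg_closure"
  interpret L: algebraic_closure L "R.indexed_const ` carrier R"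
    unfolding L_def by (rule R.alg_closureE)
  interpret H: ring_hom_ring R L R.indexed_const
    using R.alg_closureE(2) R.ring_axioms L.ring_axioms
    by (auto intro: ring_hom_ringI2 simp: L_def)
  have "[k] \<cdot>\<^bsub>R\<^esub> \<one>\<^bsub>R\<^esub> = int k mod int p" for k :: nat
    by (induction k) (auto simp: R.res_zero_eq R.res_one_eq R.res_add_eq mod_simps add.commute)
  then have "[p] \<cdot>\<^bsub>R\<^esub> \<one>\<^bsub>R\<^esub> = \<zero>\<^bsub>R\<^esub>" by (simp add: R.res_zero_eq)
  moreover have "R.indexed_const ([k] \<cdot>\<^bsub>R\<^esub> \<one>\<^bsub>R\<^esub>) = [k] \<cdot>\<^bsub>L\<^esub> \<one>\<^bsub>L\<^esub>" for k :: nat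
    by (induction k) auto
  ultimately have ch: "[p] \<cdot>\<^bsub>L\<^esub> \<one>\<^bsub>L\<^esub> = \<zero>\<^bsub>L\<^esub>" by (metis H.hom_zero)
  define K where "K = {x \<in> carrier L. x [^]\<^bsub>L\<^esub> (p ^ m) = x}"
  have K: "subfield K L" unfolding K_def by (rule L.subfield_frobenius_fixed[OF p ch])
  have "[k] \<cdot>\<^bsub>L\<lparr>carrier := K\<rparr>\<^esub> x = [k] \<cdot>\<^bsub>L\<^esub> x" for k :: nat and x
    by (simp add: add_pow_def nat_pow_def)
  moreover have "x [^]\<^bsub>L\<lparr>carrier := K\<rparr>\<^esub> k = x [^]\<^bsub>L\<^esub> k" for k :: nat and x
    by (simp add: nat_pow_def)
  ultimately show ?thesis
    using L.subfield_iff(2)[OF K] L.card_frobenius_fixed[OF p ch m] ch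
    by (intro exI[of _ "L\<lparr>carrier := K\<rparr>"]) (auto simp: K_def)
qed

section \<open>The unitary graph of a polarity\<close>

text \<open>Lines are not separate objects: the set of points perpendicular to \<open>x\<close> is
  the polar line of \<open>x\<close>, in a plane of order q^2. Thus \<open>unique_common\<close>
  says that two lines meet in one point, \<open>absolute_line\<close> that the polar of an absolute
  point is a tangent, and \<open>nonabsolute_line\<close> that every other line is a secant.\<close>

locale unitary_polarity =
  fixes P :: "'a set" and perp :: "'a \<Rightarrow> 'a \<Rightarrow> bool" (infix \<open>\<bottom>\<close> 50) and q :: nat
  assumes finite_points: "finite P"
    and card_points: "card P = q^4 + q^2 + 1"
    and perp_sym: "x \<bottom> y \<Longrightarrow> y \<bottom> x"
    and unique_common: "x \<in> P \<Longrightarrow> y \<in> P \<Longrightarrow> x \<noteq> y \<Longrightarrow> \<exists>!z. z \<in> P \<and> x \<bottom> z \<and> y \<bottom> z"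
    and card_line: "x \<in> P \<Longrightarrow> card {y \<in> P. x \<bottom> y} = q^2 + 1"
    and absolute_line: "x \<in> P \<Longrightarrow> y \<in> P \<Longrightarrow> x \<bottom> x \<Longrightarrow> y \<bottom> y \<Longrightarrow> x \<bottom> y \<Longrightarrow> y = x"
    and nonabsolute_line: "x \<in> P \<Longrightarrow> \<not> x \<bottom> x \<Longrightarrow> card {y \<in> P. x \<bottom> y \<and> y \<bottom> y} = q + 1"
begin

definition N :: "'a set" where "N = {x \<in> P. \<not> x \<bottom> x}"

lemma finite_N: "finite N"
  using finite_points by (simp add: N_def)

lemma common_unique:
  assumes "x \<in> P" "y \<in> P" "x \<noteq> y" "u \<in> P" "x \<bottom> u" "y \<bottom> u" "v \<in> P" "x \<bottom> v" "y \<bottom> v"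
  shows "u = v"
  using unique_common[OF assms(1-3)] assms(4-) by blast

lemma card_N_nbrs:
  assumes "x \<in> N"
  shows "card {y \<in> N. x \<bottom> y} + q = q^2"
proof -
  have "card {y \<in> P. x \<bottom> y} = card ({y \<in> N. x \<bottom> y} \<union> {y \<in> P. x \<bottom> y \<and> y \<bottom> y})"
    by (intro arg_cong[of _ _ card]) (auto simp: N_def)
  also have "\<dots> = card {y \<in> N. x \<bottom> y} + card {y \<in> P. x \<bottom> y \<and> y \<bottom> y}"
    using finite_points finite_N by (intro card_Un_disjoint) (auto simp: N_def)
  finally show ?thesis using assms card_line[of x] nonabsolute_line[of x] by (simp add: N_def)
qed

text \<open>Double counting of perpendicular pairs: a point of \<open>N\<close> has q + 1 absolute
  partners, and an absolute point has q^2 partners in \<open>N\<close>, its tangent containing no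
  absolute point but itself.\<close>

lemma card_N: "card N + q^3 = q^4 + q^2"
proof -
  define A where "A = {x \<in> P. x \<bottom> x}"
  have fA: "finite A" using finite_points by (simp add: A_def)
  have "card P = card (N \<union> A)" by (intro arg_cong[of _ _ card]) (auto simp: N_def A_def)
  also have "\<dots> = card N + card A"
    using fA finite_N by (intro card_Un_disjoint) (auto simp: N_def A_def)
  finally have tot: "card N + card A = q^4 + q^2 + 1" using card_points by simp
  have "(\<Sum>x\<in>N. card {a \<in> A. x \<bottom> a}) = (\<Sum>a\<in>A. q^2)"
  proof (rule sum_multicount_gen[OF finite_N fA], rule ballI)
    fix a assume a: "a \<in> A"
    have "{y \<in> P. a \<bottom> y} = insert a {x \<in> N. x \<bottom> a}"
      using a absolute_line[of a] perp_sym by (auto simp: A_def N_def)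
    moreover have "a \<notin> {x \<in> N. x \<bottom> a}" using a by (auto simp: A_def N_def)
    ultimately show "card {x \<in> N. x \<bottom> a} = q^2"
      using card_line[of a] a finite_N by (simp add: A_def)
  qed
  moreover have "card {a \<in> A. x \<bottom> a} = q + 1" if "x \<in> N" for x
  proof -
    have "{a \<in> A. x \<bottom> a} = {y \<in> P. x \<bottom> y \<and> y \<bottom> y}" by (auto simp: A_def)
    then show ?thesis using nonabsolute_line[of x] that by (simp add: N_def)
  qed
  ultimately have "card N * (q + 1) = card A * q^2" by simp
  then have "int (card N) * (int q + 1) = int (card A) * int q ^ 2"
    by (metis of_nat_mult of_nat_add of_nat_1 of_nat_power)
  moreover have "int (card A) = int q^4 + int q^2 + 1 - int (card N)"
    using tot by (simp flip: of_nat_power of_nat_add)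
  ultimately have "int (card N) * (int q^2 + int q + 1) = int q^2 * (int q^4 + int q^2 + 1)"
    by (simp add: algebra_simps)
  \<comment> \<open>By q^4 + q^2 + 1 = (q^2 + q + 1)(q^2 - q + 1), the factor q^2 + q + 1 can be
    cancelled.\<close>
  also have "\<dots> = (int q^4 + int q^2 - int q^3) * (int q^2 + int q + 1)"
    by (simp add: algebra_simps power_numeral_reduce)
  finally have "int (card N) = int q^4 + int q^2 - int q^3"
    by (subst (asm) mult_cancel_right) (smt (verit) zero_le_power2 of_nat_0_le_iff)
  then have "int (card N + q^3) = int (q^4 + q^2)" by simp
  then show ?thesis by (simp only: of_nat_eq_iff)
qed

lemma card_common_le:
  assumes "x \<in> N" "y \<in> N" "x \<noteq> y"
  shows "card {z \<in> N. x \<bottom> z \<and> y \<bottom> z} = 0 \<or> card {z \<in> N. x \<bottom> z \<and> y \<bottom> z} = 1"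
proof -
  have "card {z \<in> N. x \<bottom> z \<and> y \<bottom> z} \<le> 1"
    using assms common_unique[of x y] finite_points
    by (subst card_le_Suc0_iff_eq[folded One_nat_def]) (auto simp: N_def)
  then show ?thesis by linarith
qed

text \<open>The common perpendicular z completes a self-polar triangle. Were z absolute, both y and
  z would be perpendicular to x and to z, forcing y = z although y is not absolute.\<close>

lemma card_common_adjacent:
  assumes x: "x \<in> N" and y: "y \<in> N" and xy: "x \<bottom> y"
  shows "card {z \<in> N. x \<bottom> z \<and> y \<bottom> z} = 1"
proof -
  have ne: "x \<noteq> y" using assms by (auto simp: N_def)
  then obtain z where z: "z \<in> P" "x \<bottom> z" "y \<bottom> z"
    using unique_common[of x y] x y by (auto simp: N_def)
  have "z \<in> N"
  proof (rule ccontr)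
    assume "z \<notin> N"
    then have "z \<bottom> z" using z by (simp add: N_def)
    then have "y = z"
      using x y z xy by (intro common_unique[of x z]) (auto simp: N_def perp_sym)
    then show False using y \<open>z \<notin> N\<close> by simp
  qed
  then have "{z \<in> N. x \<bottom> z \<and> y \<bottom> z} \<noteq> {}" using z by blast
  then have "card {z \<in> N. x \<bottom> z \<and> y \<bottom> z} \<noteq> 0" using finite_N by simp
  then show ?thesis using card_common_le[OF x y ne] by simp
qed

text \<open>This is the (x, y) entry of A^3 at nonadjacent x, y. Of the q^2 + 1 points z on the
  polar line of x, those are dropped that are absolute or whose common perpendicular with y is
  absolute: q + 1 of each kind, with an overlap of at most one.\<close>

lemma card_two_step:
  assumes x: "x \<in> N" and y: "y \<in> N" and ne: "x \<noteq> y" and xy: "\<not> x \<bottom> y"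
  shows "card {z \<in> N. x \<bottom> z \<and> card {w \<in> N. y \<bottom> w \<and> z \<bottom> w} = 1} + 2 * q + 1 =
    q^2 + (if card {z \<in> N. x \<bottom> z \<and> y \<bottom> z} = 0 then 1 else 0)"
proof -
  \<comment> \<open>The pole of the line through \<open>u\<close> and \<open>v\<close>, equivalently
    the meet of their polar lines.\<close>
  define c where "c u v = (THE z. z \<in> P \<and> u \<bottom> z \<and> v \<bottom> z)" for u v
  have c: "c u v \<in> P" "u \<bottom> c u v" "v \<bottom> c u v" if "u \<in> P" "v \<in> P" "u \<noteq> v" for u v
    using theI'[OF unique_common[OF that]] by (auto simp: c_def)
  have c_eq: "c u v = z" if "u \<in> P" "v \<in> P" "u \<noteq> v" "z \<in> P" "u \<bottom> z" "v \<bottom> z" for u v z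
    using common_unique[OF that(1-3) c[OF that(1-3)]] that by blast
  have xP: "x \<in> P" "y \<in> P" using x y by (auto simp: N_def)
  let ?L = "{z \<in> P. x \<bottom> z}"
  \<comment> \<open>The inverse is \<open>c x\<close>, because z is itself perpendicular to x and to
    \<open>c y z\<close>. Nonperpendicularity of x and y keeps the two arguments of \<open>c\<close>
    distinct throughout.\<close>
  have bij: "bij_betw (c y) ?L {w \<in> P. y \<bottom> w}"
  proof (rule bij_betw_byWitness[where f' = "c x"])
    show "\<forall>z\<in>?L. c x (c y z) = z"
      using c[of y] c_eq[of x _] xP xy by (smt (verit) mem_Collect_eq perp_sym)
    show "\<forall>w\<in>{w \<in> P. y \<bottom> w}. c y (c x w) = w"
      using c[of x] c_eq[of y _] xP xy by (smt (verit) mem_Collect_eq perp_sym)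
    show "c y ` ?L \<subseteq> {w \<in> P. y \<bottom> w}" using c[of y] xP xy perp_sym by auto
    show "c x ` {w \<in> P. y \<bottom> w} \<subseteq> ?L"
      using c[of x] xP xy perp_sym[of y x] by blast
  qed
  define B1 where "B1 = {z \<in> ?L. z \<bottom> z}"
  define B2 where "B2 = {z \<in> ?L. c y z \<bottom> c y z}"
  have fL: "finite ?L" using finite_points by simp
  have cB1: "card B1 = q + 1"
    using nonabsolute_line[of x] x by (simp add: B1_def N_def conj_assoc)
  have "c y ` B2 = {w \<in> P. y \<bottom> w \<and> w \<bottom> w}"
    using bij unfolding B2_def bij_betw_def by auto
  moreover have "inj_on (c y) B2"
    using bij unfolding bij_betw_def by (auto simp: B2_def intro: inj_on_subset)
  ultimately have cB2: "card B2 = q + 1"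
    using nonabsolute_line[of y] y by (metis (no_types, lifting) N_def card_image mem_Collect_eq)
  \<comment> \<open>If z and \<open>c y z\<close> are both absolute, then, being perpendicular, they
    coincide, so z is perpendicular to y as well.\<close>
  have int_eq: "B1 \<inter> B2 = {z \<in> P. z \<bottom> z \<and> x \<bottom> z \<and> y \<bottom> z}"
  proof (intro equalityI subsetI)
    fix z assume z: "z \<in> B1 \<inter> B2"
    then have "z \<noteq> y" using xy by (auto simp: B1_def)
    then have "z = c y z"
      using z c[of y z] xP absolute_line[of "c y z" z] perp_sym by (auto simp: B1_def B2_def)
    then show "z \<in> {z \<in> P. z \<bottom> z \<and> x \<bottom> z \<and> y \<bottom> z}"
      using z c[of y z] xP \<open>z \<noteq> y\<close> by (auto simp: B1_def)
  next
    fix z assume z: "z \<in> {z \<in> P. z \<bottom> z \<and> x \<bottom> z \<and> y \<bottom> z}"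
    moreover have "c y z = z" using z xP xy by (intro c_eq) auto
    ultimately show "z \<in> B1 \<inter> B2" by (auto simp: B1_def B2_def)
  qed
  \<comment> \<open>The single point \<open>c x y\<close> is either absolute, and then it is the
    overlap, or it is a common neighbour in \<open>N\<close>.\<close>
  have int_card: "card (B1 \<inter> B2) + card {z \<in> N. x \<bottom> z \<and> y \<bottom> z} = 1"
  proof -
    have "card (B1 \<inter> B2) + card {z \<in> N. x \<bottom> z \<and> y \<bottom> z} =
        card ((B1 \<inter> B2) \<union> {z \<in> N. x \<bottom> z \<and> y \<bottom> z})"
      using finite_N finite_points by (subst card_Un_disjoint) (auto simp: int_eq N_def)
    also have "(B1 \<inter> B2) \<union> {z \<in> N. x \<bottom> z \<and> y \<bottom> z} = {c x y}"
    proof -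
      have "(B1 \<inter> B2) \<union> {z \<in> N. x \<bottom> z \<and> y \<bottom> z} = {z \<in> P. x \<bottom> z \<and> y \<bottom> z}"
        by (auto simp: int_eq N_def)
      also have "\<dots> = {c x y}" using c[OF xP ne] c_eq[OF xP ne] by blast
      finally show ?thesis .
    qed
    finally show ?thesis by simp
  qed
  have S_eq: "{z \<in> N. x \<bottom> z \<and> card {w \<in> N. y \<bottom> w \<and> z \<bottom> w} = 1} = ?L - (B1 \<union> B2)"
  proof -
    have "card {w \<in> N. y \<bottom> w \<and> z \<bottom> w} = 1 \<longleftrightarrow> \<not> c y z \<bottom> c y z"
      if z: "z \<in> P" "x \<bottom> z" for z
    proof -
      have yz: "y \<noteq> z" using xy z by auto
      have "{w \<in> P. y \<bottom> w \<and> z \<bottom> w} = {c y z}"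
        using c[OF xP(2) z(1) yz] c_eq[OF xP(2) z(1) yz] by blast
      then have "{w \<in> N. y \<bottom> w \<and> z \<bottom> w} = {c y z} \<inter> {w. \<not> w \<bottom> w}"
        by (auto simp: N_def)
      then show ?thesis by (simp add: Int_insert_left)
    qed
    then show ?thesis by (auto simp: B1_def B2_def N_def)
  qed
  have "card (?L - (B1 \<union> B2)) + card (B1 \<union> B2) = q^2 + 1"
  proof -
    have "B1 \<union> B2 \<subseteq> ?L" by (auto simp: B1_def B2_def)
    then show ?thesis
      using fL card_line[OF xP(1)] card_mono[OF fL] finite_subset[OF _ fL] by (simp add: card_Diff_subset)
  qed
  moreover have "card (B1 \<union> B2) + card (B1 \<inter> B2) = 2 * (q + 1)"
  proof -
    have "finite B1" "finite B2" using finite_points by (simp_all add: B1_def B2_def)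
    then show ?thesis using card_Un_Int[of B1 B2] cB1 cB2 by simp
  qed
  ultimately show ?thesis unfolding S_eq using int_card by auto
qed

end

lemma card_transport:
  assumes "bij_betw f {..<n} A"
  shows "card {z. z < n \<and> Q (f z)} = card {z \<in> A. Q z}"
proof -
  have "f ` {z. z < n \<and> Q (f z)} = {z \<in> A. Q z}"
    using assms unfolding bij_betw_def by auto
  moreover have "inj_on f {z. z < n \<and> Q (f z)}"
    using assms unfolding bij_betw_def by (auto intro: inj_on_subset)
  then have "card (f ` {z. z < n \<and> Q (f z)}) = card {z. z < n \<and> Q (f z)}" by (rule card_image)
  ultimately show ?thesis by simp
qed

text \<open>The interface between geometry and linear algebra: these counts are all that passes from
  the polarity to the matrix identities. Terms are moved to the left-hand sides so that no truncated
  subtraction occurs.\<close>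

locale unitary_graph =
  fixes n :: nat and E :: "nat \<Rightarrow> nat \<Rightarrow> bool" and q :: nat
  assumes order: "n + q^3 = q^4 + q^2"
    and simple: "simple_graph n E"
    and degree: "x < n \<Longrightarrow> card {y. y < n \<and> E x y} + q = q^2"
    and common: "x < n \<Longrightarrow> y < n \<Longrightarrow> x \<noteq> y \<Longrightarrow> common_nbrs n E x y = 0 \<or> common_nbrs n E x y = 1"
    and common_adjacent: "E x y \<Longrightarrow> common_nbrs n E x y = 1"
    and two_step: "x < n \<Longrightarrow> y < n \<Longrightarrow> x \<noteq> y \<Longrightarrow> \<not> E x y \<Longrightarrow>
      card {z. z < n \<and> E x z \<and> common_nbrs n E y z = 1} + 2 * q + 1 =
      q^2 + (if common_nbrs n E x y = 0 then 1 else 0)"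

lemma (in unitary_polarity) exists_unitary_graph:
  "\<exists>E. unitary_graph (card N) E q"
proof -
  let ?n = "card N"
  obtain f where f: "bij_betw f {..<?n} N"
    using ex_bij_betw_nat_finite[OF finite_N] by (auto simp: atLeast0LessThan)
  define E where "E i j \<longleftrightarrow> i < ?n \<and> j < ?n \<and> f i \<bottom> f j" for i j
  have fN: "f i \<in> N" if "i < ?n" for i using f that by (auto simp: bij_betw_def)
  have inj: "f i \<noteq> f j" if "i < ?n" "j < ?n" "i \<noteq> j" for i j
    using f that by (auto simp: bij_betw_def inj_on_def)
  have cn: "common_nbrs ?n E i j = card {z \<in> N. f i \<bottom> z \<and> f j \<bottom> z}" if "i < ?n" "j < ?n" for i j
    unfolding common_nbrs_def card_transport[OF f, symmetric]
    using that by (intro arg_cong[of _ _ card]) (auto simp: E_def)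
  have "unitary_graph ?n E q"
  proof
    show "?n + q^3 = q^4 + q^2" by (rule card_N)
    show "simple_graph ?n E" using fN perp_sym by (auto simp: simple_graph_def E_def N_def)
    show "card {y. y < ?n \<and> E x y} + q = q^2" if "x < ?n" for x
    proof -
      have "{y. y < ?n \<and> E x y} = {y. y < ?n \<and> f x \<bottom> f y}" using that by (auto simp: E_def)
      then show ?thesis using card_N_nbrs[OF fN[OF that]] by (simp add: card_transport[OF f])
    qed
    show "common_nbrs ?n E x y = 0 \<or> common_nbrs ?n E x y = 1"
      if "x < ?n" "y < ?n" "x \<noteq> y" for x y
      using that by (simp only: cn) (intro card_common_le fN inj)
    show "common_nbrs ?n E x y = 1" if "E x y" for x y
    proof -
      have "x < ?n" "y < ?n" "f x \<bottom> f y" using that by (auto simp: E_def)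
      then show ?thesis using fN by (simp only: cn card_common_adjacent)
    qed
    show "card {z. z < ?n \<and> E x z \<and> common_nbrs ?n E y z = 1} + 2 * q + 1 =
      q^2 + (if common_nbrs ?n E x y = 0 then 1 else 0)"
      if xy: "x < ?n" "y < ?n" "x \<noteq> y" "\<not> E x y" for x y
    proof -
      have "{z. z < ?n \<and> E x z \<and> common_nbrs ?n E y z = 1} =
        {z. z < ?n \<and> (f x \<bottom> f z \<and> card {w \<in> N. f y \<bottom> w \<and> f z \<bottom> w} = 1)}"
        using xy by (auto simp: E_def cn)
      then have "card {z. z < ?n \<and> E x z \<and> common_nbrs ?n E y z = 1} =
        card {z \<in> N. f x \<bottom> z \<and> card {w \<in> N. f y \<bottom> w \<and> z \<bottom> w} = 1}"
        using card_transport[OF f, of "\<lambda>z. f x \<bottom> z \<and> card {w \<in> N. f y \<bottom> w \<and> z \<bottom> w} = 1"] by simp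
      then show ?thesis
        using card_two_step[of "f x" "f y"] xy fN inj by (simp add: cn E_def)
    qed
  qed
  then show ?thesis by blast
qed

section \<open>The Hermitian polarity over a field of order $q^2$\<close>

lemma sum_nat_attains_bound:
  fixes f :: "'a \<Rightarrow> nat"
  assumes fin: "finite A" and a: "card A \<le> a" and b: "\<And>x. x \<in> A \<Longrightarrow> f x \<le> b"
    and sum: "sum f A = a * b" and x: "x \<in> A"
  shows "f x = b"
proof (rule ccontr)
  assume "f x \<noteq> b"
  then have "sum f A < sum (\<lambda>_. b) A"
    using b x by (intro sum_strict_mono_ex1[OF fin]) (auto intro!: bexI[of _ x] simp: le_neq_trans)
  also have "\<dots> \<le> a * b" using a by simp
  finally show False using sum by simp
qed

text \<open>Here \<open>bar\<close> is the conjugation over the subfield of order q, which appears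
  only as its set of fixed elements. Absolute points on a polar line are later parametrised by a
  norm fibre or by a trace fibre.\<close>

locale unitary_field = field R for R (structure) +
  fixes q :: nat and bar :: "'a \<Rightarrow> 'a"
  assumes finite_carrier: "finite (carrier R)"
    and card_carrier: "card (carrier R) = q^2"
    and bar_closed [simp, intro]: "x \<in> carrier R \<Longrightarrow> bar x \<in> carrier R"
    and bar_bar [simp]: "x \<in> carrier R \<Longrightarrow> bar (bar x) = x"
    and bar_add [simp]: "x \<in> carrier R \<Longrightarrow> y \<in> carrier R \<Longrightarrow> bar (x \<oplus> y) = bar x \<oplus> bar y"
    and bar_mult [simp]: "x \<in> carrier R \<Longrightarrow> y \<in> carrier R \<Longrightarrow> bar (x \<otimes> y) = bar x \<otimes> bar y"
    and card_norm_fibre: "t \<in> carrier R \<Longrightarrow> bar t = t \<Longrightarrow> t \<noteq> \<zero> \<Longrightarrow>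
      card {u \<in> carrier R. u \<otimes> bar u = t} = q + 1"
    and card_trace_fibre: "t \<in> carrier R \<Longrightarrow> bar t = t \<Longrightarrow>
      card {u \<in> carrier R. u \<oplus> bar u = t} = q"

text \<open>The trace fibres have at most $q$ elements, the norm fibres over nonzero elements at most
  $q + 1$, and the fixed field at most $q$. As the fibres partition $q^2$ and $q^2 - 1 = (q - 1)(q + 1)$
  elements, respectively, all these bounds are attained.\<close>

lemma unitary_field_frobenius:
  fixes p m :: nat and F (structure)
  assumes F: "field F" and p: "prime p" and m: "m > 0"
    and fin: "finite (carrier F)" and card: "card (carrier F) = (p ^ m)^2"
    and ch: "[p] \<cdot> \<one> = \<zero>" and fixed: "\<And>x. x \<in> carrier F \<Longrightarrow> x [^] ((p ^ m)^2) = x"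
  shows "unitary_field F (p ^ m) (\<lambda>x. x [^] (p ^ m))"
proof -
  interpret field F by (rule F)
  define q where "q = p ^ m"
  define bar where "bar x = x [^] q" for x
  have q: "q > 1" unfolding q_def using prime_gt_1_nat[OF p] m by (rule one_less_power)
  have closed [simp, intro]: "bar x \<in> carrier F" if "x \<in> carrier F" for x using that by (simp add: bar_def)
  have add: "bar (x \<oplus> y) = bar x \<oplus> bar y" if "x \<in> carrier F" "y \<in> carrier F" for x y
    using that by (simp add: bar_def q_def frobenius_add[OF p ch])
  have minus: "bar (\<ominus> x) = \<ominus> bar x" if "x \<in> carrier F" for x
    using that by (simp add: bar_def q_def frobenius_minus[OF p ch])
  have mult: "bar (x \<otimes> y) = bar x \<otimes> bar y" if "x \<in> carrier F" "y \<in> carrier F" for x y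
    using that by (simp add: bar_def nat_pow_distrib)
  have bb: "bar (bar x) = x" if "x \<in> carrier F" for x
    using fixed[OF that] that by (simp add: bar_def nat_pow_pow q_def power2_eq_square)
  define B where "B = {t \<in> carrier F. bar t = t}"
  have fB: "finite B" using fin by (simp add: B_def)
  \<comment> \<open>Nonzero fixed elements are roots of x^(q - 1) = 1.\<close>
  have B0: "card (B - {\<zero>}) \<le> q - 1"
  proof -
    have "x [^] (q - 1) = \<one>" if "x \<in> B - {\<zero>}" for x
    proof -
      have x: "x \<in> carrier F" "x \<noteq> \<zero>" "x [^] q = x" using that by (auto simp: B_def bar_def)
      have "x \<otimes> x [^] (q - 1) = x [^] Suc (q - 1)" using x by (simp only: nat_pow_Suc2)
      also have "\<dots> = x \<otimes> \<one>" using x q by simp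
      finally show ?thesis using x m_lcancel[of x "x [^] (q - 1)" \<one>] by simp
    qed
    then have "card (B - {\<zero>}) \<le> card {x \<in> carrier F. x [^] (q - 1) = \<one>}"
      using fin by (intro card_mono) (auto simp: B_def)
    also have "\<dots> \<le> q - 1" using q by (intro num_roots_le_deg[OF fin]) simp
    finally show ?thesis .
  qed
  have z: "\<zero> \<in> B" using q by (simp add: B_def bar_def nat_pow_zero)
  have cB: "card B \<le> q" using B0 z fB q by simp
  define T where "T t = {u \<in> carrier F. u \<oplus> bar u = t}" for t
  define M where "M t = {u \<in> carrier F. u \<otimes> bar u = t}" for t
  have fT: "finite (T t)" "finite (M t)" for t using fin by (auto simp: T_def M_def)
  \<comment> \<open>Elements of trace zero satisfy bar u = -u, so the quotient of two of them is
    fixed; division by a nonzero one embeds the kernel in \<open>B\<close>. Any other trace fibre is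
    a translate of the kernel.\<close>
  have T0: "card (T \<zero>) \<le> q"
  proof (cases "T \<zero> \<subseteq> {\<zero>}")
    case True
    then have "card (T \<zero>) \<le> card {\<zero>}" by (intro card_mono) auto
    then show ?thesis using q by simp
  next
    case False
    then obtain v where v: "v \<in> carrier F" "v \<noteq> \<zero>" "v \<oplus> bar v = \<zero>" by (auto simp: T_def)
    have vu: "v \<in> Units F" using v by (simp add: field_Units)
    have neg: "bar u = \<ominus> u" if "u \<in> carrier F" "u \<oplus> bar u = \<zero>" for u
      using that minus_equality[of "bar u" u] by (simp add: a_comm)
    have "inj_on (\<lambda>u. u \<otimes> inv v) (T \<zero>)"
      using vu v by (intro inj_on_inverseI[where g = "\<lambda>w. w \<otimes> v"]) (auto simp: T_def m_assoc)
    moreover have "(\<lambda>u. u \<otimes> inv v) ` T \<zero> \<subseteq> B"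
    proof
      fix w assume "w \<in> (\<lambda>u. u \<otimes> inv v) ` T \<zero>"
      then obtain u where u: "u \<in> carrier F" "u \<oplus> bar u = \<zero>" "w = u \<otimes> inv v" by (auto simp: T_def)
      have w: "w \<in> carrier F" using u vu by simp
      have wv: "w \<otimes> v = u" using u vu v by (simp add: m_assoc)
      have "bar w \<otimes> bar v = bar u" using mult[OF w v(1)] wv by simp
      then have "\<ominus> (bar w \<otimes> v) = \<ominus> u"
        unfolding neg[OF u(1,2)] neg[OF v(1,3)] r_minus[OF closed[OF w] v(1)] .
      then have "\<ominus> (\<ominus> (bar w \<otimes> v)) = \<ominus> (\<ominus> u)" by (rule arg_cong)
      then have "bar w \<otimes> v = u"
        unfolding minus_minus[OF m_closed[OF closed[OF w] v(1)]] minus_minus[OF u(1)] .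
      then have "bar w = w" using wv w v m_rcancel[of v "bar w" w] by simp
      then show "w \<in> B" using w by (simp add: B_def)
    qed
    ultimately have "card (T \<zero>) \<le> card B" by (rule card_inj_on_le) (rule fB)
    then show ?thesis using cB by simp
  qed
  have Tle: "card (T t) \<le> q" for t
  proof (cases "T t = {}")
    case False
    then obtain v where v: "v \<in> carrier F" "v \<oplus> bar v = t" by (auto simp: T_def)
    have "inj_on (\<lambda>u. u \<oplus> \<ominus> v) (T t)"
      using v by (intro inj_onI) (auto simp: T_def)
    moreover have "(\<lambda>u. u \<oplus> \<ominus> v) ` T t \<subseteq> T \<zero>"
    proof
      fix w assume "w \<in> (\<lambda>u. u \<oplus> \<ominus> v) ` T t"
      then obtain u where u: "u \<in> carrier F" "u \<oplus> bar u = t" "w = u \<oplus> \<ominus> v" by (auto simp: T_def)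
      have "w \<oplus> bar w = (u \<oplus> bar u) \<oplus> \<ominus> (v \<oplus> bar v)"
        using u(1) v(1) by (simp add: u(3) add minus minus_add a_ac)
      also have "\<dots> = t \<oplus> \<ominus> t" using u v by simp
      also have "\<dots> = \<zero>" using u by (intro r_neg) auto
      finally show "w \<in> T \<zero>" using u v by (simp add: T_def)
    qed
    ultimately have "card (T t) \<le> card (T \<zero>)" by (rule card_inj_on_le) (rule fT)
    then show ?thesis using T0 by simp
  qed simp
  \<comment> \<open>The norm is u^(q + 1), so dividing by one element of the fibre lands among the
    roots of w^(q + 1) = 1.\<close>
  have Mle: "card (M t) \<le> q + 1" if t: "t \<noteq> \<zero>" for t
  proof (cases "M t = {}")
    case False
    then obtain v where v: "v \<in> carrier F" "v \<otimes> bar v = t" by (auto simp: M_def)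
    have "v \<noteq> \<zero>" using v t closed by fastforce
    then have vu: "v \<in> Units F" using v by (simp add: field_Units)
    have pw: "u [^] (q + 1) = u \<otimes> bar u" if "u \<in> carrier F" for u
      using that by (simp add: bar_def m_comm)
    have "inj_on (\<lambda>u. u \<otimes> inv v) (M t)"
      using vu v by (intro inj_on_inverseI[where g = "\<lambda>w. w \<otimes> v"]) (auto simp: M_def m_assoc)
    moreover have "(\<lambda>u. u \<otimes> inv v) ` M t \<subseteq> {x \<in> carrier F. x [^] (q + 1) = \<one>}"
    proof
      fix w assume "w \<in> (\<lambda>u. u \<otimes> inv v) ` M t"
      then obtain u where u: "u \<in> carrier F" "u \<otimes> bar u = t" "w = u \<otimes> inv v" by (auto simp: M_def)
      have tc: "t \<in> carrier F" using u by auto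
      have w: "w \<in> carrier F" using u vu by simp
      have wv: "w \<otimes> v = u" using u vu v by (simp add: m_assoc)
      have "w [^] (q + 1) \<otimes> t = (w \<otimes> v) [^] (q + 1)"
        using w v by (simp only: nat_pow_distrib pw)
      also have "\<dots> = \<one> \<otimes> t" using wv u tc by (simp only: pw l_one)
      finally have "w [^] (q + 1) = \<one>"
        using w tc t m_rcancel[of t "w [^] (q + 1)" \<one>] nat_pow_closed[OF w, of "q + 1"] one_closed by blast
      then show "w \<in> {x \<in> carrier F. x [^] (q + 1) = \<one>}" using w by simp
    qed
    ultimately have "card (M t) \<le> card {x \<in> carrier F. x [^] (q + 1) = \<one>}"
      by (rule card_inj_on_le) (use fin in simp)
    also have "\<dots> \<le> q + 1" by (intro num_roots_le_deg[OF fin]) simp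
    finally show ?thesis .
  qed simp
  have Teq: "card (T t) = q" if "t \<in> B" for t
  proof (rule sum_nat_attains_bound[OF fB cB Tle _ that])
    have "carrier F = (\<Union>t\<in>B. T t)"
      by (auto simp: B_def T_def add bb a_comm)
    moreover have "card (\<Union>t\<in>B. T t) = (\<Sum>t\<in>B. card (T t))"
      using fB fT by (intro card_UN_disjoint) (auto simp: T_def)
    ultimately show "(\<Sum>t\<in>B. card (T t)) = q * q"
      using card by (simp add: q_def power2_eq_square)
  qed
  have Meq: "card (M t) = q + 1" if "t \<in> B - {\<zero>}" for t
  proof (rule sum_nat_attains_bound[OF _ B0 Mle _ that])
    have z0: "bar \<zero> = \<zero>" using z by (simp add: B_def)
    have "u \<otimes> bar u \<noteq> \<zero>" if "u \<in> carrier F" "u \<noteq> \<zero>" for u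
      using integral_iff[of u "bar u"] bb[of u] z0 that closed by metis
    then have "carrier F - {\<zero>} = (\<Union>t\<in>B - {\<zero>}. M t)"
      by (auto simp: B_def M_def mult bb m_comm) blast
    moreover have "card (\<Union>t\<in>B - {\<zero>}. M t) = (\<Sum>t\<in>B - {\<zero>}. card (M t))"
      using fB fT by (intro card_UN_disjoint) (auto simp: M_def)
    moreover have "card (carrier F - {\<zero>}) = q * q - 1"
      using card fin by (simp add: q_def power2_eq_square)
    moreover have "q * q - 1 = (q - 1) * (q + 1)" by (simp add: algebra_simps)
    ultimately show "(\<Sum>t\<in>B - {\<zero>}. card (M t)) = (q - 1) * (q + 1)" by simp
  qed (use fB in auto)
  have "unitary_field F q bar"
  proof
    show "card (carrier F) = q^2" using card by (simp add: q_def)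
    show "card {u \<in> carrier F. u \<otimes> bar u = t} = q + 1"
      if "t \<in> carrier F" "bar t = t" "t \<noteq> \<zero>" for t
      using Meq[of t] that by (simp add: M_def B_def)
    show "card {u \<in> carrier F. u \<oplus> bar u = t} = q" if "t \<in> carrier F" "bar t = t" for t
      using Teq[of t] that by (simp add: T_def B_def)
  qed (simp_all add: fin add mult bb)
  then show ?thesis by (simp only: q_def bar_def[abs_def])
qed

section \<open>Coordinates for the Hermitian polarity\<close>

datatype 'a unital_point = Aff 'a 'a | Inf 'a | Apex

context unitary_field
begin

lemma bar_zero [simp]: "bar \<zero> = \<zero>"
proof -
  have "bar \<zero> \<oplus> bar \<zero> = bar \<zero> \<oplus> \<zero>" using bar_add[of \<zero> \<zero>] by simp
  then show ?thesis by (metis add.l_cancel bar_closed zero_closed)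
qed

lemma bar_minus [simp]: "x \<in> carrier R \<Longrightarrow> bar (\<ominus> x) = \<ominus> bar x"
  using bar_add[of "\<ominus> x" x] minus_equality[of "bar (\<ominus> x)" "bar x"] by (simp add: l_neg)

lemma bar_eq_iff [simp]: "x \<in> carrier R \<Longrightarrow> y \<in> carrier R \<Longrightarrow> bar x = bar y \<longleftrightarrow> x = y"
  by (metis bar_bar)

definition points :: "'a unital_point set" where
  "points = (\<lambda>(a, b). Aff a b) ` (carrier R \<times> carrier R) \<union> Inf ` carrier R \<union> {Apex}"

text \<open>Orthogonality for the Hermitian form $x_1 \overline{y_3} + x_2 \overline{y_2} + x_3 \overline{y_1}$,
  where \<open>Aff a b\<close>, \<open>Inf c\<close> and \<open>Apex\<close> stand for the points with homogeneous coordinates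
  $(1,a,b)$, $(0,1,c)$ and $(0,0,1)$.\<close>

fun orth :: "'a unital_point \<Rightarrow> 'a unital_point \<Rightarrow> bool" where
  "orth (Aff a b) (Aff c d) \<longleftrightarrow> bar d \<oplus> a \<otimes> bar c \<oplus> b = \<zero>"
| "orth (Aff a b) (Inf c) \<longleftrightarrow> bar c \<oplus> a = \<zero>"
| "orth (Inf c) (Aff a b) \<longleftrightarrow> bar c \<oplus> a = \<zero>"
| "orth (Inf c) (Inf d) \<longleftrightarrow> False"
| "orth (Aff a b) Apex \<longleftrightarrow> False"
| "orth Apex (Aff a b) \<longleftrightarrow> False"
| "orth (Inf c) Apex \<longleftrightarrow> True"
| "orth Apex (Inf c) \<longleftrightarrow> True"
| "orth Apex Apex \<longleftrightarrow> True"

text \<open>The ordinate at abscissa \<open>c\<close> on the polar line of \<open>Aff a b\<close>,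
  an affine line of slope -bar a.\<close>

definition slope_pt :: "'a \<Rightarrow> 'a \<Rightarrow> 'a \<Rightarrow> 'a" where
  "slope_pt a b c = \<ominus> (bar b \<oplus> bar a \<otimes> c)"

lemma slope_pt_closed [simp]:
  "a \<in> carrier R \<Longrightarrow> b \<in> carrier R \<Longrightarrow> c \<in> carrier R \<Longrightarrow> slope_pt a b c \<in> carrier R"
  by (simp add: slope_pt_def)

lemma orth_Aff_Aff:
  assumes "a \<in> carrier R" "b \<in> carrier R" "c \<in> carrier R" "d \<in> carrier R"
  shows "orth (Aff a b) (Aff c d) \<longleftrightarrow> d = slope_pt a b c"
proof -
  have "bar d \<oplus> a \<otimes> bar c \<oplus> b = \<zero> \<longleftrightarrow> bar (bar d \<oplus> a \<otimes> bar c \<oplus> b) = bar \<zero>"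
    using assms by (subst bar_eq_iff) auto
  also have "bar (bar d \<oplus> a \<otimes> bar c \<oplus> b) = d \<oplus> (bar b \<oplus> bar a \<otimes> c)"
    using assms by (simp add: a_ac)
  also have "\<dots> = bar \<zero> \<longleftrightarrow> d = slope_pt a b c"
    using assms by (auto simp: slope_pt_def l_neg intro!: minus_equality[symmetric])
  finally show ?thesis by simp
qed

lemma orth_Aff_Inf:
  assumes "a \<in> carrier R" "c \<in> carrier R"
  shows "bar c \<oplus> a = \<zero> \<longleftrightarrow> a = \<ominus> bar c" and "bar c \<oplus> a = \<zero> \<longleftrightarrow> c = \<ominus> bar a"
proof -
  show 1: "bar c \<oplus> a = \<zero> \<longleftrightarrow> a = \<ominus> bar c"
    using assms minus_equality[of a "bar c"] by (auto simp: r_neg a_comm)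
  have "a = \<ominus> bar c \<longleftrightarrow> bar a = bar (\<ominus> bar c)" using assms by (subst bar_eq_iff) auto
  also have "\<dots> \<longleftrightarrow> c = \<ominus> bar a" using assms by (metis bar_bar bar_closed bar_minus minus_minus)
  finally show "bar c \<oplus> a = \<zero> \<longleftrightarrow> c = \<ominus> bar a" using 1 by simp
qed

text \<open>Membership is built in because the symmetry axiom of \<open>unitary_polarity\<close> has
  no membership premise, whereas \<open>bar\<close> is known to be an involution only on the
  carrier.\<close>

definition perp :: "'a unital_point \<Rightarrow> 'a unital_point \<Rightarrow> bool" where
  "perp x y \<longleftrightarrow> x \<in> points \<and> y \<in> points \<and> orth x y"

lemma points_cases:
  assumes "x \<in> points"
  obtains a b where "a \<in> carrier R" "b \<in> carrier R" "x = Aff a b"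
  | c where "c \<in> carrier R" "x = Inf c"
  | "x = Apex"
  using assms by (auto simp: points_def)

lemma points_simps [simp]:
  "Aff a b \<in> points \<longleftrightarrow> a \<in> carrier R \<and> b \<in> carrier R"
  "Inf c \<in> points \<longleftrightarrow> c \<in> carrier R"
  "Apex \<in> points"
  by (auto simp: points_def)

text \<open>The polars of affine points are the nonvertical lines with their point at infinity;
  those of \<open>Inf c\<close> and \<open>Apex\<close> below are the vertical lines and the line at
  infinity.\<close>

lemma line_Aff:
  assumes "a \<in> carrier R" "b \<in> carrier R"
  shows "{y \<in> points. perp (Aff a b) y} =
    insert (Inf (\<ominus> bar a)) ((\<lambda>c. Aff c (slope_pt a b c)) ` carrier R)"
  using assms orth_Aff_Inf(2)[of a] by (auto simp: perp_def points_def orth_Aff_Aff l_neg simp del: orth.simps(1))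

lemma line_Inf:
  assumes "c \<in> carrier R"
  shows "{y \<in> points. perp (Inf c) y} = insert Apex (Aff (\<ominus> bar c) ` carrier R)"
  using assms orth_Aff_Inf(1)[of _ c] by (auto simp: perp_def points_def)

lemma line_Apex: "{y \<in> points. perp Apex y} = insert Apex (Inf ` carrier R)"
  by (auto simp: perp_def points_def)

lemma perp_sym:
  assumes "perp x y" shows "perp y x"
proof -
  have "orth y x" if "x = Aff a b" "y = Aff c d" "a \<in> carrier R" "b \<in> carrier R" "c \<in> carrier R" "d \<in> carrier R"
    for a b c d
  proof -
    have "bar (bar d \<oplus> a \<otimes> bar c \<oplus> b) = \<zero>" using assms that by (simp add: perp_def)
    then show ?thesis using that by (simp add: a_ac m_comm)
  qed
  moreover have "x \<in> points" "y \<in> points" "orth x y" using assms by (auto simp: perp_def)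
  ultimately show ?thesis
    by (cases "\<exists>a b c d. x = Aff a b \<and> y = Aff c d") (auto simp: perp_def points_def)
qed

lemma linear_unique:
  assumes "s \<in> carrier R" "t \<in> carrier R" "s \<noteq> \<zero>"
  shows "\<exists>!c. c \<in> carrier R \<and> s \<otimes> c = t"
proof (rule ex1I[of _ "inv s \<otimes> t"])
  have u: "s \<in> Units R" using assms by (simp add: field_Units)
  show "inv s \<otimes> t \<in> carrier R \<and> s \<otimes> (inv s \<otimes> t) = t"
    using u assms by (simp add: m_assoc[symmetric])
  show "c = inv s \<otimes> t" if "c \<in> carrier R \<and> s \<otimes> c = t" for c
    using u assms that by (auto simp: m_assoc[symmetric])
qed

lemma slope_pt_meet:
  assumes c: "a \<in> carrier R" "b \<in> carrier R" "a' \<in> carrier R" "b' \<in> carrier R" and ne: "a \<noteq> a'"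
  shows "\<exists>!c. c \<in> carrier R \<and> slope_pt a b c = slope_pt a' b' c"
proof -
  have "slope_pt a b c = slope_pt a' b' c \<longleftrightarrow> (bar a \<ominus> bar a') \<otimes> c = bar b' \<ominus> bar b" if cc: "c \<in> carrier R" for c
  proof -
    have "slope_pt a b c = slope_pt a' b' c \<longleftrightarrow> bar b \<oplus> bar a \<otimes> c = bar b' \<oplus> bar a' \<otimes> c"
      unfolding slope_pt_def using c cc by (metis a_closed bar_closed m_closed minus_minus)
    also have "\<dots> \<longleftrightarrow> (bar b \<oplus> bar a \<otimes> c) \<ominus> (bar b' \<oplus> bar a' \<otimes> c) = \<zero>"
      using c cc by (subst r_right_minus_eq) auto
    also have "(bar b \<oplus> bar a \<otimes> c) \<ominus> (bar b' \<oplus> bar a' \<otimes> c) = (bar a \<ominus> bar a') \<otimes> c \<ominus> (bar b' \<ominus> bar b)"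
      using c cc bar_closed by algebra
    also have "\<dots> = \<zero> \<longleftrightarrow> (bar a \<ominus> bar a') \<otimes> c = bar b' \<ominus> bar b"
      using c cc by (subst r_right_minus_eq) auto
    finally show ?thesis .
  qed
  moreover have "\<exists>!c. c \<in> carrier R \<and> (bar a \<ominus> bar a') \<otimes> c = bar b' \<ominus> bar b"
    using c ne by (intro linear_unique) auto
  ultimately show ?thesis by (metis (no_types, lifting))
qed

lemma slope_pt_parallel:
  assumes "a \<in> carrier R" "b \<in> carrier R" "b' \<in> carrier R" "c \<in> carrier R"
  shows "slope_pt a b c = slope_pt a b' c \<longleftrightarrow> b = b'"
  using assms unfolding slope_pt_def by (metis add.r_cancel bar_bar bar_closed m_closed a_closed minus_minus)

text \<open>Polar lines are intersected case by case: affine lines of equal slope meet at infinity,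
  and those of distinct slopes meet where a linear equation with coefficient bar a - bar a' is
  solved.\<close>

lemma unique_common:
  assumes x: "x \<in> points" and y: "y \<in> points" and ne: "x \<noteq> y"
  shows "\<exists>!z. z \<in> points \<and> perp x z \<and> perp y z"
proof -
  have AA: ?thesis if "x = Aff a b" "y = Aff a' b'" for a b a' b'
  proof -
    have c: "a \<in> carrier R" "b \<in> carrier R" "a' \<in> carrier R" "b' \<in> carrier R" using x y that by auto
    have eq: "z \<in> points \<and> perp x z \<and> perp y z \<longleftrightarrow>
      z \<in> insert (Inf (\<ominus> bar a)) ((\<lambda>c. Aff c (slope_pt a b c)) ` carrier R) \<and>
      z \<in> insert (Inf (\<ominus> bar a')) ((\<lambda>c. Aff c (slope_pt a' b' c)) ` carrier R)" for z
      unfolding that line_Aff[OF c(1,2), symmetric] line_Aff[OF c(3,4), symmetric] by auto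
    show ?thesis
    proof (cases "a = a'")
      case True
      then have "b \<noteq> b'" using ne that by simp
      then show ?thesis unfolding eq using c True slope_pt_parallel[of a b b']
        by (intro ex1I[of _ "Inf (\<ominus> bar a)"]) auto
    next
      case False
      obtain e where e: "e \<in> carrier R" "slope_pt a b e = slope_pt a' b' e"
        "\<And>c. c \<in> carrier R \<Longrightarrow> slope_pt a b c = slope_pt a' b' c \<Longrightarrow> c = e"
        using slope_pt_meet[OF c False] by blast
      have "\<ominus> bar a \<noteq> \<ominus> bar a'" using c False by (metis bar_bar bar_closed minus_minus)
      then have "z = Aff e (slope_pt a b e)" if "z \<in> points \<and> perp x z \<and> perp y z" for z
        using that e(3) unfolding eq by fastforce
      moreover have "Aff e (slope_pt a b e) \<in> points \<and> perp x (Aff e (slope_pt a b e)) \<and>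
          perp y (Aff e (slope_pt a b e))"
        unfolding eq using e(2) imageI[OF e(1), of "\<lambda>c. Aff c (slope_pt a b c)"]
          imageI[OF e(1), of "\<lambda>c. Aff c (slope_pt a' b' c)"] by simp
      ultimately show ?thesis by blast
    qed
  qed
  have AI: "\<exists>!z. z \<in> points \<and> perp u z \<and> perp v z" if "u = Aff a b" "v = Inf c" "u \<in> points" "v \<in> points" for u v a b c
  proof -
    have c: "a \<in> carrier R" "b \<in> carrier R" "c \<in> carrier R" using that by auto
    have eq: "z \<in> points \<and> perp u z \<and> perp v z \<longleftrightarrow>
      z \<in> insert (Inf (\<ominus> bar a)) ((\<lambda>c. Aff c (slope_pt a b c)) ` carrier R) \<and>
      z \<in> insert Apex (Aff (\<ominus> bar c) ` carrier R)" for z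
      unfolding that line_Aff[OF c(1,2), symmetric] line_Inf[OF c(3), symmetric] by auto
    show ?thesis unfolding eq using c
      by (intro ex1I[of _ "Aff (\<ominus> bar c) (slope_pt a b (\<ominus> bar c))"]) auto
  qed
  have AX: "\<exists>!z. z \<in> points \<and> perp u z \<and> perp v z" if "u = Aff a b" "v = Apex" "u \<in> points" for u v a b
  proof -
    have c: "a \<in> carrier R" "b \<in> carrier R" using that by auto
    have eq: "z \<in> points \<and> perp u z \<and> perp v z \<longleftrightarrow>
      z \<in> insert (Inf (\<ominus> bar a)) ((\<lambda>c. Aff c (slope_pt a b c)) ` carrier R) \<and>
      z \<in> insert Apex (Inf ` carrier R)" for z
      unfolding that line_Aff[OF c(1,2), symmetric] line_Apex[symmetric] by auto
    show ?thesis unfolding eq using c by (intro ex1I[of _ "Inf (\<ominus> bar a)"]) auto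
  qed
  have II: ?thesis if "x = Inf c" "y = Inf d" for c d
  proof -
    have c: "c \<in> carrier R" "d \<in> carrier R" "c \<noteq> d" using x y ne that by auto
    have eq: "z \<in> points \<and> perp x z \<and> perp y z \<longleftrightarrow>
      z \<in> insert Apex (Aff (\<ominus> bar c) ` carrier R) \<and> z \<in> insert Apex (Aff (\<ominus> bar d) ` carrier R)" for z
      unfolding that line_Inf[OF c(1), symmetric] line_Inf[OF c(2), symmetric] by auto
    have "\<ominus> bar c \<noteq> \<ominus> bar d" using c by (metis bar_bar bar_closed minus_minus)
    then show ?thesis unfolding eq by (intro ex1I[of _ Apex]) auto
  qed
  have IX: "\<exists>!z. z \<in> points \<and> perp u z \<and> perp v z" if "u = Inf c" "v = Apex" "u \<in> points" for u v c
    using that by (intro ex1I[of _ Apex]) (auto simp: perp_def points_def)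
  have swap: ?thesis if "\<exists>!z. z \<in> points \<and> perp y z \<and> perp x z"
    using that by (simp add: conj_commute)
  show ?thesis
  proof (rule points_cases[OF x])
    fix a b assume xa: "x = Aff a b"
    show ?thesis
    proof (rule points_cases[OF y])
      show ?thesis if "y = Aff c d" for c d by (rule AA[OF xa that])
      show ?thesis if "y = Inf c" for c by (rule AI[OF xa that x y])
      show ?thesis if "y = Apex" by (rule AX[OF xa that x])
    qed
  next
    fix c assume xc: "x = Inf c"
    show ?thesis
    proof (rule points_cases[OF y])
      show ?thesis if "y = Aff a b" for a b by (rule swap[OF AI[OF that xc y x]])
      show ?thesis if "y = Inf d" for d by (rule II[OF xc that])
      show ?thesis if "y = Apex" by (rule IX[OF xc that x])
    qed
  next
    assume xx: "x = Apex"
    show ?thesis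
    proof (rule points_cases[OF y])
      show ?thesis if "y = Aff a b" for a b by (rule swap[OF AX[OF that xx y]])
      show ?thesis if "y = Inf c" for c by (rule swap[OF IX[OF that xx y]])
      show ?thesis if "y = Apex" using that xx ne by simp
    qed
  qed
qed

text \<open>The value of the Hermitian form at the vector (1, a, b).\<close>

definition height :: "'a \<Rightarrow> 'a \<Rightarrow> 'a" where "height a b = b \<oplus> bar b \<oplus> a \<otimes> bar a"

lemma absolute_iff [simp]:
  "a \<in> carrier R \<Longrightarrow> b \<in> carrier R \<Longrightarrow> perp (Aff a b) (Aff a b) \<longleftrightarrow> height a b = \<zero>"
  "\<not> perp (Inf c) (Inf c)" "perp Apex Apex"
  by (auto simp: perp_def height_def a_ac)

text \<open>Along the polar line of \<open>Aff a b\<close> the form is the norm of c - a minus a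
  constant. So absolute points there form a norm fibre over \<open>height a b\<close>, which shrinks
  to c = a when \<open>Aff a b\<close> is absolute.\<close>

lemma height_slope_pt:
  assumes "a \<in> carrier R" "b \<in> carrier R" "c \<in> carrier R"
  shows "height c (slope_pt a b c) = (c \<ominus> a) \<otimes> bar (c \<ominus> a) \<ominus> height a b"
proof -
  \<comment> \<open>Naming the conjugates turns the claim into a polynomial identity in six free
    elements, within reach of \<open>algebra\<close>.\<close>
  define A B C where "A = bar a" and "B = bar b" and "C = bar c"
  have ABC: "A \<in> carrier R" "B \<in> carrier R" "C \<in> carrier R" using assms by (auto simp: A_def B_def C_def)
  have "height c (slope_pt a b c) = \<ominus> (B \<oplus> A \<otimes> c) \<oplus> (\<ominus> (b \<oplus> a \<otimes> C)) \<oplus> c \<otimes> C"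
    using assms by (simp add: height_def slope_pt_def A_def B_def C_def)
  also have "\<dots> = (c \<ominus> a) \<otimes> (C \<ominus> A) \<ominus> (b \<oplus> B \<oplus> a \<otimes> A)"
    using assms ABC by algebra
  also have "\<dots> = (c \<ominus> a) \<otimes> bar (c \<ominus> a) \<ominus> height a b"
    using assms by (simp add: height_def minus_eq A_def B_def C_def)
  finally show ?thesis .
qed

lemma height_closed [simp]: "a \<in> carrier R \<Longrightarrow> b \<in> carrier R \<Longrightarrow> height a b \<in> carrier R"
  by (simp add: height_def)

lemma bar_height: "a \<in> carrier R \<Longrightarrow> b \<in> carrier R \<Longrightarrow> bar (height a b) = height a b"
  by (simp add: height_def a_ac m_comm)

lemma norm_eq_zero: "u \<in> carrier R \<Longrightarrow> u \<otimes> bar u = \<zero> \<longleftrightarrow> u = \<zero>"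
  using bar_eq_iff[of u \<zero>] by (auto simp: integral_iff)

sublocale unitary_polarity points perp q
proof
  have inj: "inj_on (\<lambda>(a, b). Aff a b) (carrier R \<times> carrier R)" "inj_on Inf (carrier R)"
    by (auto intro!: inj_onI)
  show fin: "finite points" using finite_carrier by (simp add: points_def)
  have "card points = card ((\<lambda>(a, b). Aff a b) ` (carrier R \<times> carrier R)) + card (Inf ` carrier R) + 1"
    unfolding points_def using finite_carrier
    by (subst card_Un_disjoint, force, force, force, subst card_Un_disjoint) auto
  also have "\<dots> = (q^2 * q^2) + q^2 + 1"
    by (simp add: card_image inj card_cartesian_product card_carrier)
  finally show "card points = q^4 + q^2 + 1" by (simp add: power_add[symmetric])
  show "perp x y \<Longrightarrow> perp y x" for x y by (rule perp_sym)
  show "\<exists>!z. z \<in> points \<and> perp x z \<and> perp y z" if "x \<in> points" "y \<in> points" "x \<noteq> y" for x y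
    by (rule unique_common[OF that])
  show "card {y \<in> points. perp x y} = q^2 + 1" if "x \<in> points" for x
    using that
  proof (cases x rule: points_cases)
    case (1 a b)
    have "card ((\<lambda>c. Aff c (slope_pt a b c)) ` carrier R) = q^2"
      unfolding card_carrier[symmetric] by (intro card_image inj_onI) simp
    then show ?thesis unfolding 1(3) line_Aff[OF 1(1,2)] using finite_carrier by (subst card_insert_disjoint) auto
  next
    case (2 c)
    have "card (Aff (\<ominus> bar c) ` carrier R) = q^2"
      unfolding card_carrier[symmetric] by (intro card_image inj_onI) simp
    then show ?thesis unfolding 2(2) line_Inf[OF 2(1)] using finite_carrier by (subst card_insert_disjoint) auto
  next
    case 3
    have "card (Inf ` carrier R) = q^2"
      unfolding card_carrier[symmetric] by (rule card_image[OF inj(2)])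
    then show ?thesis unfolding 3 line_Apex using finite_carrier by (subst card_insert_disjoint) auto
  qed
  show "y = x" if xy: "x \<in> points" "y \<in> points" "perp x x" "perp y y" "perp x y" for x y
    using xy(1)
  proof (cases x rule: points_cases)
    case (1 a b)
    have "y \<in> insert (Inf (\<ominus> bar a)) ((\<lambda>c. Aff c (slope_pt a b c)) ` carrier R)"
      unfolding line_Aff[OF 1(1,2), symmetric] using xy 1 by simp
    then obtain c where c: "c \<in> carrier R" "y = Aff c (slope_pt a b c)" using xy(4) by auto
    have ab: "height a b = \<zero>" using xy(3) 1 by simp
    have "height c (slope_pt a b c) = \<zero>" using xy(4) c 1 by simp
    then have "(c \<ominus> a) \<otimes> bar (c \<ominus> a) = \<zero>"
      using height_slope_pt[OF 1(1,2) c(1)] 1 c ab by (simp add: minus_eq)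
    then have ca: "c = a" using norm_eq_zero[of "c \<ominus> a"] c 1 by simp
    have "orth (Aff a b) (Aff a b)" using xy(3) 1 by (simp add: perp_def)
    then have "b = slope_pt a b a" using orth_Aff_Aff[of a b a b] 1 by simp
    then show ?thesis using c ca 1 by simp
  next
    case (2 c)
    then show ?thesis using xy by simp
  next
    case 3
    then have "y \<in> insert Apex (Inf ` carrier R)" unfolding line_Apex[symmetric] using xy by simp
    then show ?thesis using xy(4) 3 by auto
  qed
  show "card {y \<in> points. perp x y \<and> perp y y} = q + 1" if x: "x \<in> points" "\<not> perp x x" for x
    using x(1)
  proof (cases x rule: points_cases)
    case (1 a b)
    \<comment> \<open>The substitution u = c - a matches the absolute points with the norm fibre
      over \<open>t\<close>.\<close>
    define t where "t = height a b"
    have t: "t \<in> carrier R" "bar t = t" "t \<noteq> \<zero>" using x 1 by (auto simp: t_def bar_height)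
    have "{y \<in> points. perp x y \<and> perp y y} = {y \<in> {y \<in> points. perp (Aff a b) y}. perp y y}"
      using 1 by auto
    also have "\<dots> = (\<lambda>c. Aff c (slope_pt a b c)) ` {c \<in> carrier R. height c (slope_pt a b c) = \<zero>}"
      unfolding line_Aff[OF 1(1,2)] using 1 by auto
    finally have "card {y \<in> points. perp x y \<and> perp y y} =
      card ((\<lambda>c. Aff c (slope_pt a b c)) ` {c \<in> carrier R. height c (slope_pt a b c) = \<zero>})"
      by (rule arg_cong)
    also have "\<dots> = card {c \<in> carrier R. height c (slope_pt a b c) = \<zero>}"
      by (intro card_image inj_onI) simp
    also have "\<dots> = card {c \<in> carrier R. (c \<ominus> a) \<otimes> bar (c \<ominus> a) = t}"
      using 1 t by (intro arg_cong[of _ _ card] Collect_cong conj_cong refl)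
        (simp add: height_slope_pt t_def del: bar_add)
    also have "\<dots> = card {u \<in> carrier R. u \<otimes> bar u = t}"
    proof (rule bij_betw_same_card[OF bij_betw_byWitness[where f = "\<lambda>c. c \<ominus> a" and f' = "\<lambda>u. u \<oplus> a"]])
      have [simp]: "c \<ominus> a \<oplus> a = c" "c \<oplus> a \<ominus> a = c" if "c \<in> carrier R" for c
        using that 1 by (simp_all add: minus_eq a_assoc l_neg r_neg)
      show "\<forall>c\<in>{c \<in> carrier R. (c \<ominus> a) \<otimes> bar (c \<ominus> a) = t}. c \<ominus> a \<oplus> a = c" by simp
      show "\<forall>u\<in>{u \<in> carrier R. u \<otimes> bar u = t}. u \<oplus> a \<ominus> a = u" by simp
      show "(\<lambda>c. c \<ominus> a) ` {c \<in> carrier R. (c \<ominus> a) \<otimes> bar (c \<ominus> a) = t} \<subseteq> {u \<in> carrier R. u \<otimes> bar u = t}"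
        using 1 by auto
      show "(\<lambda>u. u \<oplus> a) ` {u \<in> carrier R. u \<otimes> bar u = t} \<subseteq> {c \<in> carrier R. (c \<ominus> a) \<otimes> bar (c \<ominus> a) = t}"
        using 1 by auto
    qed
    also have "\<dots> = q + 1" by (rule card_norm_fibre[OF t])
    finally show ?thesis .
  next
    case (2 c)
    \<comment> \<open>On the vertical line at -bar c, \<open>height\<close> vanishes exactly when d
      has trace \<open>t\<close>. This gives q affine absolute points, and \<open>Apex\<close> is
      the one more.\<close>
    define t where "t = \<ominus> (bar c \<otimes> c)"
    have t: "t \<in> carrier R" "bar t = t" using 2 by (auto simp: t_def m_comm)
    have h: "height (\<ominus> bar c) d = \<zero> \<longleftrightarrow> d \<oplus> bar d = t" if d: "d \<in> carrier R" for d
    proof -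
      have "height (\<ominus> bar c) d = (d \<oplus> bar d) \<ominus> t"
        using d 2 by (simp add: height_def t_def minus_eq l_minus r_minus)
      then show ?thesis using d t by simp
    qed
    have "{y \<in> points. perp x y \<and> perp y y} = {y \<in> {y \<in> points. perp (Inf c) y}. perp y y}"
      using 2 by auto
    also have "\<dots> = insert Apex (Aff (\<ominus> bar c) ` {d \<in> carrier R. d \<oplus> bar d = t})"
      unfolding line_Inf[OF 2(1)] using 2 h by auto
    finally have "card {y \<in> points. perp x y \<and> perp y y} =
      card (insert Apex (Aff (\<ominus> bar c) ` {d \<in> carrier R. d \<oplus> bar d = t}))"
      by (rule arg_cong)
    also have "\<dots> = Suc (card (Aff (\<ominus> bar c) ` {d \<in> carrier R. d \<oplus> bar d = t}))"
      using finite_carrier by (intro card_insert_disjoint) auto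
    also have "card (Aff (\<ominus> bar c) ` {d \<in> carrier R. d \<oplus> bar d = t}) = q"
      unfolding card_trace_fibre[OF t, symmetric] by (intro card_image inj_onI) simp
    finally show ?thesis by simp
  next
    case 3
    then show ?thesis using x by simp
  qed
qed

end

theorem unitary_graph_exists:
  assumes "primepow q"
  shows "\<exists>n E. unitary_graph n E q"
proof -
  obtain p m where p: "prime p" and m: "m > 0" and q: "q = p ^ m"
    using assms by (auto simp: primepow_def)
  obtain F :: "((int list \<times> nat) multiset \<Rightarrow> int) ring" where F: "field F" "finite (carrier F)"
    "card (carrier F) = p ^ (2 * m)" "[p] \<cdot>\<^bsub>F\<^esub> \<one>\<^bsub>F\<^esub> = \<zero>\<^bsub>F\<^esub>"
    "\<forall>x\<in>carrier F. x [^]\<^bsub>F\<^esub> (p ^ (2 * m)) = x"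
    using finite_field_exists[OF p, of "2 * m"] m by auto
  have sq: "p ^ (2 * m) = (p ^ m)^2" by (simp add: power_mult[symmetric] mult.commute)
  interpret unitary_field F q "\<lambda>x. x [^]\<^bsub>F\<^esub> q"
    unfolding q using F unfolding sq by (intro unitary_field_frobenius p m) auto
  show ?thesis using exists_unitary_graph by blast
qed

section \<open>Matrix identities and the children\<close>

lemma sum_delta_mult_left:
  fixes h :: "nat \<Rightarrow> real"
  assumes "i < n"
  shows "(\<Sum>l<n. of_bool (i = l) * h l) = h i"
  using assms by (simp add: of_bool_def if_distrib[of "\<lambda>x. x * _"] cong: if_cong)

lemma sum_delta_mult_right:
  fixes h :: "nat \<Rightarrow> real"
  assumes "j < n"
  shows "(\<Sum>l<n. h l * of_bool (l = j)) = h j"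
  using assms by (simp add: of_bool_def if_distrib[of "\<lambda>x. _ * x"] cong: if_cong)

lemma real_common_nbrs:
  assumes "simple_graph n G"
  shows "real (common_nbrs n G i j) = (\<Sum>l<n. of_bool (G i l) * of_bool (G l j))"
proof -
  have "{z. z < n \<and> G i z \<and> G j z} = {l \<in> {..<n}. G i l \<and> G l j}"
    using assms by (auto simp: simple_graph_def)
  then show ?thesis
    unfolding common_nbrs_def by (simp add: of_bool_conj[symmetric] sum_of_bool_eq Int_def)
qed

text \<open>The hypothesis on common neighbours says that the adjacency matrix $B$ satisfies
  $B^2 = \alpha I + \beta B + \gamma J$.\<close>

lemma srg_from_square:
  fixes \<alpha> \<beta> \<gamma> :: real
  assumes G: "simple_graph n G"
    and sq: "\<And>i j. i < n \<Longrightarrow> j < n \<Longrightarrow>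
      real (common_nbrs n G i j) = \<alpha> * of_bool (i = j) + \<beta> * of_bool (G i j) + \<gamma>"
    and K: "real K = \<alpha> + \<gamma>" "0 < K" "K + 1 < n"
    and lam: "real lam = \<beta> + \<gamma>" and mu: "real mu = \<gamma>"
  shows "srg n G K lam mu"
proof -
  have irr: "\<not> G i i" for i using G by (auto simp: simple_graph_def)
  have deg: "card {y. y < n \<and> G x y} = K" if "x < n" for x
  proof -
    have "card {y. y < n \<and> G x y} = common_nbrs n G x x" by (simp add: common_nbrs_def)
    then show ?thesis using sq[OF that that] K(1) irr[of x] by simp
  qed
  have n0: "0 < n" using K by simp
  have "\<not> complete_graph n G"
  proof
    assume "complete_graph n G"
    then have "{y. y < n \<and> G 0 y} = {..<n} - {0}" using n0 irr[of 0] by (auto simp: complete_graph_def)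
    then have "card {y. y < n \<and> G 0 y} = n - 1" using n0 by simp
    then show False using deg[OF n0] K(3) by simp
  qed
  moreover have "\<not> edgeless_graph n G"
  proof
    assume "edgeless_graph n G"
    then have "card {y. y < n \<and> G 0 y} = 0" using n0 by (auto simp: edgeless_graph_def)
    then show False using deg[OF n0] K(2) by simp
  qed
  moreover have "common_nbrs n G x y = lam" if "x < n" "y < n" "x \<noteq> y" "G x y" for x y
    using sq[OF that(1,2)] that lam by simp
  moreover have "common_nbrs n G x y = mu" if "x < n" "y < n" "x \<noteq> y" "\<not> G x y" for x y
    using sq[OF that(1,2)] that mu by simp
  ultimately show ?thesis using G deg by (auto simp: srg_def regular_graph_def)
qed

context unitary_graph
begin

definition a :: "nat \<Rightarrow> nat \<Rightarrow> real" where "a i j = of_bool (E i j)"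

definition m2 :: "nat \<Rightarrow> nat \<Rightarrow> real" where "m2 i j = (\<Sum>l<n. a i l * a l j)"

lemma E_sym: "E i j \<longleftrightarrow> E j i" and E_irrefl: "\<not> E i i"
  using simple by (auto simp: simple_graph_def)

lemma a_sym: "a i j = a j i"
  by (simp add: a_def E_sym[of i j])

lemma m2_eq: "m2 i j = real (common_nbrs n E i j)"
  unfolding real_common_nbrs[OF simple] m2_def a_def ..

lemma common_nbrs_commute: "common_nbrs n E i j = common_nbrs n E j i"
  unfolding common_nbrs_def by (simp only: conj_commute)

lemma real_order: "real n = real q^4 + real q^2 - real q^3"
  using order by (simp add: algebra_simps flip: of_nat_power of_nat_add)

abbreviation k :: real where "k \<equiv> real q^2 - real q"

lemma real_degree: "x < n \<Longrightarrow> real (card {y. y < n \<and> E x y}) = k"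
  using degree[of x] by (simp add: algebra_simps flip: of_nat_power of_nat_add)

lemma m2_diag: "i < n \<Longrightarrow> m2 i i = k"
  using real_degree[of i] by (simp add: m2_eq common_nbrs_def)

lemma sum_a: "i < n \<Longrightarrow> (\<Sum>l<n. a i l) = k"
  unfolding a_def by (subst real_degree[symmetric]) (simp_all add: of_bool_def sum.If_cases Collect_conj_eq lessThan_def)

lemma sum_a_mult: 
  assumes "i < n"
  shows "(\<Sum>l<n. a i l * f l) = (\<Sum>l | l < n \<and> E i l. f l)"
proof -
  have "(\<Sum>l<n. a i l * f l) = (\<Sum>l<n. if E i l then f l else 0)"
    by (intro sum.cong) (auto simp: a_def)
  also have "\<dots> = (\<Sum>l | l < n \<and> E i l. f l)"
    by (subst sum.inter_filter[symmetric]) auto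
  finally show ?thesis .
qed

text \<open>In matrix form: $A^3 + A^2 = q^2 A + q^2 I + (q^2 - 2q) J$.\<close>

lemma cubic_relation:
  assumes i: "i < n" and j: "j < n"
  shows "(\<Sum>l<n. a i l * m2 l j) =
    real q^2 * a i j + real q^2 * of_bool (i = j) + (real q^2 - 2 * real q) - m2 i j"
proof -
  let ?N = "{l. l < n \<and> E i l}"
  have cN: "real (card ?N) = k" by (rule real_degree[OF i])
  have S: "(\<Sum>l<n. a i l * m2 l j) = (\<Sum>l\<in>?N. m2 l j)" by (rule sum_a_mult[OF i])
  consider "i = j" | "E i j" | "i \<noteq> j" "\<not> E i j" by blast
  then show ?thesis
  proof cases
    case 1
    \<comment> \<open>Each edge lies in exactly one triangle, so the diagonal entry of A^3 is
      k.\<close>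
    have "(\<Sum>l\<in>?N. m2 l j) = (\<Sum>l\<in>?N. 1)"
      using 1 E_sym[of i] by (intro sum.cong) (auto simp: m2_eq common_adjacent)
    then show ?thesis using S cN 1 i E_irrefl by (simp add: m2_diag a_def)
  next
    case 2
    \<comment> \<open>Both l and j are neighbours of i, which is therefore a common neighbour. The
      term l = j contributes k, for a total of 2k - 1.\<close>
    have "m2 l j = 1" if "l \<in> ?N - {j}" for l
    proof -
      have "i \<in> {z. z < n \<and> E l z \<and> E j z}" using that 2 i E_sym by auto
      moreover have "finite {z. z < n \<and> E l z \<and> E j z}" by simp
      ultimately have "common_nbrs n E l j \<noteq> 0" unfolding common_nbrs_def by (metis card_0_eq empty_iff)
      then show ?thesis using common[of l j] that j by (auto simp: m2_eq)
    qed
    then have "(\<Sum>l\<in>?N - {j}. m2 l j) = real (card (?N - {j}))" by simp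
    moreover have jN: "j \<in> ?N" using 2 j by simp
    moreover have "card ?N \<ge> 1" using jN card_gt_0_iff[of ?N] by (auto simp: Suc_le_eq)
    ultimately have "(\<Sum>l\<in>?N. m2 l j) = m2 j j + (real (card ?N) - 1)"
      by (subst sum.remove[of _ j]) (auto simp: card_Diff_singleton of_nat_diff)
    moreover have "i \<noteq> j" using 2 E_irrefl by auto
    ultimately show ?thesis using S cN 2 j common_adjacent[OF 2] by (simp add: m2_diag a_def m2_eq[of i j])
  next
    case 3
    let ?C = "{l. l < n \<and> E i l \<and> common_nbrs n E j l = 1}"
    have "m2 l j = of_bool (common_nbrs n E j l = 1)" if "l \<in> ?N" for l
      using common[of j l] that 3 j by (auto simp: m2_eq common_nbrs_commute[of l])
    then have "(\<Sum>l\<in>?N. m2 l j) = (\<Sum>l\<in>?N. of_bool (common_nbrs n E j l = 1))"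
      by (intro sum.cong) auto
    also have "\<dots> = real (card ?C)"
      by (simp add: of_bool_def sum.If_cases Collect_conj_eq Int_assoc)
    finally have "(\<Sum>l\<in>?N. m2 l j) = real (card ?C)" .
    moreover have "real (card ?C) + 2 * real q + 1 = real q^2 + (if common_nbrs n E i j = 0 then 1 else 0)"
      using two_step[OF i j 3] by (simp flip: of_nat_power of_nat_add of_nat_mult split: if_splits)
    ultimately show ?thesis
      using S 3 common[OF i j 3(1)] by (auto simp: m2_eq a_def)
  qed
qed

lemma sum_m2: assumes i: "i < n" shows "(\<Sum>l<n. m2 i l) = k^2"
proof -
  have "(\<Sum>l<n. m2 i l) = (\<Sum>h<n. \<Sum>l<n. a i h * a h l)"
    unfolding m2_def by (rule sum.swap)
  also have "\<dots> = (\<Sum>h<n. a i h * k)" by (intro sum.cong) (auto simp: sum_distrib_left[symmetric] sum_a)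
  finally show ?thesis using sum_a[OF i] by (simp add: sum_distrib_right[symmetric] power2_eq_square)
qed

lemma m2_sym: "m2 i j = m2 j i"
  by (simp add: m2_eq common_nbrs_commute[of i])

text \<open>In matrix form: $A^4 = (q^2 + 1) A^2 - q^2 I + (q^2 - 2q)(k - 1) J$.\<close>

lemma quartic_relation:
  assumes i: "i < n" and j: "j < n"
  shows "(\<Sum>l<n. m2 i l * m2 l j) =
    (real q^2 + 1) * m2 i j - real q^2 * of_bool (i = j) + (real q^2 - 2 * real q) * (k - 1)"
proof -
  let ?c = "real q^2 - 2 * real q"
  have "(\<Sum>l<n. m2 i l * m2 l j) = (\<Sum>l<n. \<Sum>h<n. a i h * a h l * m2 l j)"
    by (simp add: m2_def[of i] sum_distrib_right)
  also have "\<dots> = (\<Sum>h<n. \<Sum>l<n. a i h * a h l * m2 l j)" by (rule sum.swap)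
  \<comment> \<open>A^4 is A times the cubic relation; the term -A^3 that this creates is removed by
    a second use of the relation, whereby q^2 A cancels.\<close>
  also have "\<dots> = (\<Sum>h<n. a i h * (real q^2 * a h j + real q^2 * of_bool (h = j) + ?c - m2 h j))"
    using j by (intro sum.cong) (auto simp: mult.assoc sum_distrib_left[symmetric] cubic_relation)
  also have "\<dots> = real q^2 * m2 i j + real q^2 * a i j + ?c * k - (\<Sum>h<n. a i h * m2 h j)"
  proof -
    have "a i h * (real q^2 * a h j + real q^2 * of_bool (h = j) + ?c - m2 h j) =
        real q^2 * (a i h * a h j) + real q^2 * (a i h * of_bool (h = j)) + ?c * a i h - a i h * m2 h j" for h
      by (simp add: algebra_simps)
    then show ?thesis
      by (simp only: sum.distrib sum_subtractf sum_distrib_left[symmetric] sum_delta_mult_right[OF j]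
          sum_a[OF i] m2_def)
  qed
  finally show ?thesis unfolding cubic_relation[OF i j] by (simp add: algebra_simps)
qed

text \<open>Both children have adjacency matrix $x A^2 + y I + z J$ for suitable scalars.\<close>

lemma m2_affine_square:
  assumes i: "i < n" and j: "j < n"
  shows "(\<Sum>l<n. (x * m2 i l + y * of_bool (i = l) + z) * (x * m2 l j + y * of_bool (l = j) + z)) =
    (x^2 * (real q^2 + 1) + 2 * x * y) * m2 i j + (y^2 - x^2 * real q^2) * of_bool (i = j) +
    (x^2 * (real q^2 - 2 * real q) * (k - 1) + 2 * x * z * k^2 + 2 * y * z + z^2 * real n)"
proof -
  have col: "(\<Sum>l<n. m2 l j) = k^2" using sum_m2[OF j] by (simp only: m2_sym[of _ j])
  have one: "(\<Sum>l<n. of_bool (i = l)) = (1::real)" "(\<Sum>l<n. of_bool (l = j)) = (1::real)"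
    using sum_delta_mult_left[OF i, of "\<lambda>_. 1"] sum_delta_mult_right[OF j, of "\<lambda>_. 1"] by simp_all
  \<comment> \<open>After summation, the mixed terms with \<open>z\<close> become multiples of J
    through A^2 J = J A^2 = k^2 J and J^2 = nJ.\<close>
  have "(x * m2 i l + y * of_bool (i = l) + z) * (x * m2 l j + y * of_bool (l = j) + z) =
      x^2 * (m2 i l * m2 l j) + (x * y) * (m2 i l * of_bool (l = j)) + (x * z) * m2 i l
      + (x * y) * (of_bool (i = l) * m2 l j) + y^2 * (of_bool (i = l) * of_bool (l = j))
      + (y * z) * of_bool (i = l) + (x * z) * m2 l j + (y * z) * of_bool (l = j) + z^2" for l
    by (simp add: algebra_simps power2_eq_square)
  then have "(\<Sum>l<n. (x * m2 i l + y * of_bool (i = l) + z) * (x * m2 l j + y * of_bool (l = j) + z)) =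
      x^2 * (\<Sum>l<n. m2 i l * m2 l j) + (x * y) * m2 i j + (x * z) * k^2
      + (x * y) * m2 i j + y^2 * of_bool (i = j)
      + (y * z) * 1 + (x * z) * k^2 + (y * z) * 1 + z^2 * real n"
    by (simp only: sum.distrib sum_distrib_left[symmetric] sum_delta_mult_right[OF j]
        sum_delta_mult_left[OF i] sum_m2[OF i] col one)
      (simp add: mult.commute)
  then show ?thesis unfolding quartic_relation[OF i j] by (simp add: algebra_simps)
qed

text \<open>Off the diagonal A^2 has entries 0 and 1, so the children are J - A^2 + (k - 1)I and A^2
  - kI.\<close>

lemma childA_entry:
  assumes "i < n" "j < n"
  shows "of_bool (childA n E 1 0 i j) = -1 * m2 i j + (k - 1) * of_bool (i = j) + 1"
  using assms common[of i j] by (cases "i = j") (auto simp: childA_def m2_diag m2_eq[of i j])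

lemma childB_entry:
  assumes "i < n" "j < n"
  shows "of_bool (childB n E 1 0 i j) = 1 * m2 i j + (- k) * of_bool (i = j) + 0"
  using assms common[of i j] by (cases "i = j") (auto simp: childB_def m2_diag m2_eq[of i j])

lemma simple_children: "simple_graph n (childA n E 1 0)" "simple_graph n (childB n E 1 0)"
  by (auto simp: simple_graph_def childA_def childB_def common_nbrs_commute)

end

section \<open>Strong regularity of the children for q > 2\<close>

locale unitary_graph_gt2 = unitary_graph +
  assumes q_gt2: "q > 2"
begin

lemma srg_childA: "srg n (childA n E 1 0) ((q - 1) * (q + 1)^2) (2 * q^2 - 2) ((q + 1)^2)"
proof (rule srg_from_square[OF simple_children(1)])
  define Q where "Q = real q"
  \<comment> \<open>The square is expanded with x = -1, y = k - 1, z = 1, and A^2 is replaced by J -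
    B + (k - 1)I, where B is the matrix of the child; \<open>?\<beta>\<close> is thus minus the
    coefficient of A^2.\<close>
  let ?\<beta> = "Q^2 - 2 * Q - 3"
  let ?\<gamma> = "(Q + 1)^2"
  let ?\<alpha> = "(Q - 1) * (Q + 1)^2 - (Q + 1)^2"
  fix i j assume ij: "i < n" "j < n"
  have "real (common_nbrs n (childA n E 1 0) i j) =
    (\<Sum>l<n. (-1 * m2 i l + (k - 1) * of_bool (i = l) + 1) * (-1 * m2 l j + (k - 1) * of_bool (l = j) + 1))"
    unfolding real_common_nbrs[OF simple_children(1)]
    using ij by (intro sum.cong refl) (simp only: childA_entry lessThan_iff)
  also have "\<dots> = ((-1)^2 * (Q^2 + 1) + 2 * (-1) * (Q^2 - Q - 1)) * m2 i j
     + ((Q^2 - Q - 1)^2 - (-1)^2 * Q^2) * of_bool (i = j) +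
     ((-1)^2 * (Q^2 - 2 * Q) * (Q^2 - Q - 1) + 2 * (-1) * 1 * (Q^2 - Q)^2 + 2 * (Q^2 - Q - 1) * 1
       + 1^2 * (Q^4 + Q^2 - Q^3))"
    unfolding m2_affine_square[OF ij] real_order Q_def ..
  also have "m2 i j = 1 - of_bool (childA n E 1 0 i j) + (Q^2 - Q - 1) * of_bool (i = j)"
    using childA_entry[OF ij] by (simp add: Q_def)
  finally show "real (common_nbrs n (childA n E 1 0) i j) =
      ?\<alpha> * of_bool (i = j) + ?\<beta> * of_bool (childA n E 1 0 i j) + ?\<gamma>"
    by (simp add: algebra_simps power_numeral_reduce)
next
  have le: "1 \<le> q" "2 \<le> 2 * q^2" using q_gt2 by (auto simp: power2_eq_square)
  show "real ((q - 1) * (q + 1)^2) = (real q - 1) * (real q + 1)^2 - (real q + 1)^2 + (real q + 1)^2"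
    using le by (simp add: of_nat_diff)
  show "real (2 * q^2 - 2) = real q^2 - 2 * real q - 3 + (real q + 1)^2"
    using le by (simp add: of_nat_diff power2_eq_square algebra_simps)
  show "real ((q + 1)^2) = (real q + 1)^2" by simp
  show "0 < (q - 1) * (q + 1)^2" using q_gt2 by simp
  have "real ((q - 1) * (q + 1)^2) + 1 < real n"
  proof -
    \<comment> \<open>Expanded around q = 3, the difference has only positive coefficients.\<close>
    define r where "r = real q - 3"
    have r: "r \<ge> 0" "real q = r + 3" using q_gt2 by (auto simp: r_def)
    have "real n - (real ((q - 1) * (q + 1)^2) + 1) = r^4 + 10 * r^3 + 36 * r^2 + 55 * r + 30"
    proof -
      have "real ((q - 1) * (q + 1)^2) = (real q - 1) * (real q + 1)^2" using le by (simp add: of_nat_diff)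
      then show ?thesis unfolding real_order by (simp add: r(2) algebra_simps power_numeral_reduce)
    qed
    moreover have "\<dots> > 0" using r by (intro add_nonneg_pos add_nonneg_nonneg) auto
    ultimately show ?thesis by simp
  qed
  then show "(q - 1) * (q + 1)^2 + 1 < n" by linarith
qed

text \<open>In all three parameters the subtracted term is at most 3q^3, so the single bound
  \<open>q3\<close> makes the natural subtractions exact.\<close>

lemma srg_childB: "is_srg n (childB n E 1 0)"
proof -
  define Q where "Q = real q"
  have q3: "3 * q^3 \<le> q^4" using q_gt2 by (simp add: power_numeral_reduce)
  have K: "real (q^4 + q - 2 * q^3) = Q^4 + Q - 2 * Q^3"
    using q3 by (subst of_nat_diff) (auto simp: Q_def)
  have lam: "real (q^4 + 4 * q + 1 - 3 * q^3) = Q^4 + 4 * Q + 1 - 3 * Q^3"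
    using q3 by (subst of_nat_diff) (auto simp: Q_def)
  have mu: "real (q^4 + q^2 + 2 * q - 3 * q^3) = Q^4 + Q^2 + 2 * Q - 3 * Q^3"
    using q3 by (subst of_nat_diff) (auto simp: Q_def)
  \<comment> \<open>With x = 1, y = -k, z = 0 the J term is that of A^4, namely (q^2 - 2q)(k - 1);
    \<open>?\<beta>\<close> is the coefficient of A^2, and \<open>?\<alpha>\<close> arises from
    replacing A^2 by B + kI.\<close>
  let ?\<alpha> = "Q^3 - Q^2 - Q" and ?\<beta> = "1 + 2 * Q - Q^2" and ?\<gamma> = "Q^4 + Q^2 + 2 * Q - 3 * Q^3"
  have "srg n (childB n E 1 0) (q^4 + q - 2 * q^3) (q^4 + 4 * q + 1 - 3 * q^3) (q^4 + q^2 + 2 * q - 3 * q^3)"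
  proof (rule srg_from_square[OF simple_children(2)])
    fix i j assume ij: "i < n" "j < n"
    have "real (common_nbrs n (childB n E 1 0) i j) =
      (\<Sum>l<n. (1 * m2 i l + (- k) * of_bool (i = l) + 0) * (1 * m2 l j + (- k) * of_bool (l = j) + 0))"
      unfolding real_common_nbrs[OF simple_children(2)]
      using ij by (intro sum.cong refl) (simp only: childB_entry lessThan_iff)
    also have "\<dots> = (1^2 * (Q^2 + 1) + 2 * 1 * (- (Q^2 - Q))) * m2 i j
       + ((- (Q^2 - Q))^2 - 1^2 * Q^2) * of_bool (i = j) +
       (1^2 * (Q^2 - 2 * Q) * (Q^2 - Q - 1) + 2 * 1 * 0 * (Q^2 - Q)^2 + 2 * (- (Q^2 - Q)) * 0 + 0^2 * real n)"
      unfolding m2_affine_square[OF ij] Q_def ..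
    also have "m2 i j = of_bool (childB n E 1 0 i j) + (Q^2 - Q) * of_bool (i = j)"
      using childB_entry[OF ij] by (simp add: Q_def)
    finally show "real (common_nbrs n (childB n E 1 0) i j) =
        ?\<alpha> * of_bool (i = j) + ?\<beta> * of_bool (childB n E 1 0 i j) + ?\<gamma>"
      by (simp add: algebra_simps power_numeral_reduce)
  next
    show "0 < q^4 + q - 2 * q^3" using q3 q_gt2 by simp
    have "q < q^2" "1 < q^3" using q_gt2 one_less_power[of q 3] by (simp_all add: power2_eq_square)
    then show "q^4 + q - 2 * q^3 + 1 < n" using q3 order by linarith
    show "real (q^4 + q - 2 * q^3) = ?\<alpha> + ?\<gamma>" unfolding K by simp
    show "real (q^4 + 4 * q + 1 - 3 * q^3) = ?\<beta> + ?\<gamma>" unfolding lam by simp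
    show "real (q^4 + q^2 + 2 * q - 3 * q^3) = ?\<gamma>" by (rule mu)
  qed
  then show ?thesis unfolding is_srg_def by blast
qed

lemma deza: "deza_graph n E (q * (q - 1)) 1 0"
proof -
  have k: "q * (q - 1) + q = q^2" using q_gt2 by (simp add: power2_eq_square algebra_simps)
  have deg: "card {y. y < n \<and> E x y} = q * (q - 1)" if "x < n" for x
    using degree[OF that] k by linarith
  have q3: "3 * q^3 \<le> q^4" using q_gt2 by (simp add: power_numeral_reduce)
  have "q > 0" "q^3 > 0" using q_gt2 by auto
  then have n0: "0 < n" using q3 order by linarith
  have kn: "0 < q * (q - 1)" "q * (q - 1) + 1 < n"
  proof -
    show "0 < q * (q - 1)" using q_gt2 by simp
    have "q > 1" "q^3 > 0" using q_gt2 by auto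
    then show "q * (q - 1) + 1 < n" using q3 order k by linarith
  qed
  have "\<not> complete_graph n E"
  proof
    assume "complete_graph n E"
    then have "{y. y < n \<and> E 0 y} = {..<n} - {0}" using n0 E_irrefl by (auto simp: complete_graph_def)
    then have "card {y. y < n \<and> E 0 y} = n - 1" using n0 by simp
    then show False using deg[OF n0] kn by simp
  qed
  moreover have "\<not> edgeless_graph n E"
  proof
    assume "edgeless_graph n E"
    then have "card {y. y < n \<and> E 0 y} = 0" using n0 by (auto simp: edgeless_graph_def)
    then show False using deg[OF n0] kn by simp
  qed
  ultimately show ?thesis using simple deg common by (auto simp: deza_graph_def regular_graph_def)
qed

lemma strongly_deza: "strongly_deza n E (q * (q - 1)) 1 0"
  using deza srg_childA srg_childB unfolding strongly_deza_def is_srg_def by blast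

end

section \<open>The spectrum\<close>

lemma index_mult_mat_sum:
  assumes "A \<in> carrier_mat n n" "B \<in> carrier_mat n n" "i < n" "j < n"
  shows "(A * B) $$ (i, j) = (\<Sum>l<n. A $$ (i, l) * B $$ (l, j))"
  using assms by (simp add: scalar_prod_def atLeast0LessThan)

definition mtrace :: "'a :: comm_monoid_add mat \<Rightarrow> 'a" where
  "mtrace A = (\<Sum>i<dim_row A. A $$ (i, i))"

lemma mtrace_mult_commute:
  fixes A B :: "'a :: comm_semiring_0 mat"
  assumes "A \<in> carrier_mat n n" "B \<in> carrier_mat n n"
  shows "mtrace (A * B) = mtrace (B * A)"
proof -
  have "mtrace (A * B) = (\<Sum>i<n. \<Sum>l<n. A $$ (i, l) * B $$ (l, i))"
    using assms by (auto simp: mtrace_def index_mult_mat_sum[OF assms] simp del: index_mult_mat(1) intro!: sum.cong)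
  also have "\<dots> = (\<Sum>l<n. \<Sum>i<n. A $$ (i, l) * B $$ (l, i))" by (rule sum.swap)
  also have "\<dots> = mtrace (B * A)"
    using assms by (auto simp: mtrace_def index_mult_mat_sum[OF assms(2,1)] mult.commute
        simp del: index_mult_mat(1) intro!: sum.cong)
  finally show ?thesis .
qed

lemma mtrace_similar:
  fixes A B :: "'a :: comm_ring_1 mat"
  assumes "similar_mat_wit A B P Q" and "A \<in> carrier_mat n n"
  shows "mtrace (A ^\<^sub>m m) = mtrace (B ^\<^sub>m m)"
proof -
  have c: "B \<in> carrier_mat n n" "P \<in> carrier_mat n n" "Q \<in> carrier_mat n n"
    and QP: "Q * P = 1\<^sub>m n"
    using similar_mat_witD2[OF assms(2,1)] by auto
  have Bm: "B ^\<^sub>m m \<in> carrier_mat n n" using c by simp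
  have "mtrace (A ^\<^sub>m m) = mtrace (P * B ^\<^sub>m m * Q)"
    using similar_mat_wit_pow_id[OF assms(1)] by simp
  also have "\<dots> = mtrace (Q * (P * B ^\<^sub>m m))"
    using c Bm by (intro mtrace_mult_commute) auto
  also have "Q * (P * B ^\<^sub>m m) = Q * P * B ^\<^sub>m m"
    by (rule assoc_mult_mat[OF c(3,2) Bm, symmetric])
  finally show ?thesis by (simp only: QP left_mult_one_mat[OF Bm])
qed

lemma upper_triangular_pow:
  fixes B :: "'a :: comm_semiring_1 mat"
  assumes B: "B \<in> carrier_mat n n" and ut: "upper_triangular B"
  shows "upper_triangular (B ^\<^sub>m m)" and "i < n \<Longrightarrow> (B ^\<^sub>m m) $$ (i, i) = (B $$ (i, i)) ^ m"
proof -
  have "upper_triangular (B ^\<^sub>m m) \<and> (\<forall>i<n. (B ^\<^sub>m m) $$ (i, i) = (B $$ (i, i)) ^ m)"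
  proof (induction m)
    case 0
    then show ?case using B by auto
  next
    case (Suc m)
    have Bm: "B ^\<^sub>m m \<in> carrier_mat n n" using B by simp
    have zero: "(B ^\<^sub>m m) $$ (i, l) * B $$ (l, j) = 0" if "i < n" "l < n" "l < i \<or> j < l" for i l j
      using that Suc.IH ut Bm B upper_triangularD[of "B ^\<^sub>m m" l i] upper_triangularD[of B j l] by auto
    have "upper_triangular (B ^\<^sub>m Suc m)"
    proof (rule upper_triangularI)
      fix i j assume "j < i" "i < dim_row (B ^\<^sub>m Suc m)"
      then have ij: "j < i" "i < n" "j < n" using B by auto
      then show "(B ^\<^sub>m Suc m) $$ (i, j) = 0"
        by (auto simp: index_mult_mat_sum[OF Bm B] intro!: sum.neutral zero)
    qed
    moreover have "(B ^\<^sub>m Suc m) $$ (i, i) = (B $$ (i, i)) ^ Suc m" if i: "i < n" for i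
    proof -
      have "(B ^\<^sub>m Suc m) $$ (i, i) = (\<Sum>l<n. (B ^\<^sub>m m) $$ (i, l) * B $$ (l, i))"
        using i by (simp add: index_mult_mat_sum[OF Bm B])
      also have "\<dots> = (\<Sum>l\<in>{i}. (B ^\<^sub>m m) $$ (i, l) * B $$ (l, i))"
        using i zero[OF i] by (intro sum.mono_neutral_right) (auto simp: nat_neq_iff)
      finally show ?thesis using Suc.IH i by (simp add: mult.commute)
    qed
    ultimately show ?case by blast
  qed
  then show "upper_triangular (B ^\<^sub>m m)" "i < n \<Longrightarrow> (B ^\<^sub>m m) $$ (i, i) = (B $$ (i, i)) ^ m" by auto
qed

text \<open>Over the complex numbers the matrix is similar to a triangular one, whose diagonal lists
  the eigenvalues with algebraic multiplicity; powers stay triangular, so the same list gives the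
  traces.\<close>

lemma complex_mat_eigenvalues:
  fixes A :: "complex mat"
  assumes A: "A \<in> carrier_mat n n"
  obtains d where "char_poly A = (\<Prod>i<n. [:- d i, 1:])"
    and "\<And>m. mtrace (A ^\<^sub>m m) = (\<Sum>i<n. d i ^ m)"
    and "\<And>i. i < n \<Longrightarrow> eigenvalue A (d i)"
proof -
  obtain es where "char_poly A = (\<Prod>a\<leftarrow>es. [:- a, 1:])" using char_poly_factorized[OF A] by blast
  then obtain B where B: "B \<in> carrier_mat n n" "upper_triangular B" "similar_mat A B"
    using schur_decomposition_exists[OF A] by blast
  define d where "d i = B $$ (i, i)" for i
  obtain P Q where wit: "similar_mat_wit A B P Q" using B(3) by (auto simp: similar_mat_def)
  have "char_poly A = (\<Prod>a\<leftarrow>diag_mat B. [:- a, 1:])"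
    using char_poly_similar[OF B(3)] char_poly_upper_triangular[OF B(1,2)] by simp
  also have "\<dots> = (\<Prod>i<n. [:- d i, 1:])"
    using B(1) by (simp add: diag_mat_def d_def prod.distinct_set_conv_list[symmetric] o_def atLeast0LessThan)
  finally have cp: "char_poly A = (\<Prod>i<n. [:- d i, 1:])" .
  moreover have "mtrace (A ^\<^sub>m m) = (\<Sum>i<n. d i ^ m)" for m
    unfolding mtrace_similar[OF wit A] using B(1) upper_triangular_pow(2)[OF B(1,2)]
    by (simp add: mtrace_def d_def)
  moreover have "eigenvalue A (d i)" if "i < n" for i
    unfolding eigenvalue_root_char_poly[OF A] cp using that by (auto simp: poly_prod)
  ultimately show ?thesis by (rule that)
qed

lemma sum_over_values:
  fixes g :: "'a \<Rightarrow> 'b :: comm_semiring_1" and n :: nat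
  assumes "finite L" "\<And>i. i < n \<Longrightarrow> d i \<in> L"
  shows "(\<Sum>i<n. g (d i)) = (\<Sum>x\<in>L. of_nat (card {i. i < n \<and> d i = x}) * g x)"
proof -
  have "(\<Sum>i<n. g (d i)) = (\<Sum>x\<in>L. \<Sum>i | i \<in> {..<n} \<and> d i = x. g (d i))"
    using assms by (intro sum.group[symmetric]) auto
  also have "\<dots> = (\<Sum>x\<in>L. of_nat (card {i. i < n \<and> d i = x}) * g x)"
    by (intro sum.cong) (auto simp: sum_constant[symmetric] simp del: sum_constant)
  finally show ?thesis .
qed

lemma prod_over_values:
  fixes g :: "'a \<Rightarrow> 'b :: comm_semiring_1" and n :: nat
  assumes "finite L" "\<And>i. i < n \<Longrightarrow> d i \<in> L"
  shows "(\<Prod>i<n. g (d i)) = (\<Prod>x\<in>L. g x ^ card {i. i < n \<and> d i = x})"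
proof -
  have "(\<Prod>i<n. g (d i)) = (\<Prod>x\<in>L. \<Prod>i | i \<in> {..<n} \<and> d i = x. g (d i))"
    using assms by (intro prod.group[symmetric]) auto
  also have "\<dots> = (\<Prod>x\<in>L. g x ^ card {i. i < n \<and> d i = x})"
    by (intro prod.cong) (auto simp: prod_constant[symmetric] simp del: prod_constant)
  finally show ?thesis .
qed

text \<open>The power sums of order $0, \dots, 3$ of the spectrum determine the multiplicities.\<close>

lemma multiplicities:
  fixes Q :: real and a b c d N :: real
  assumes Q: "Q > 2" and N: "N = Q^4 + Q^2 - Q^3"
    and e0: "a + b + c + d = N"
    and e1: "(Q^2 - Q) * a + Q * b - c - Q * d = 0"
    and e2: "(Q^2 - Q)^2 * a + Q^2 * b + c + Q^2 * d = N * (Q^2 - Q)"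
    and e3: "(Q^2 - Q)^3 * a + Q^3 * b - c - Q^3 * d = N * (Q^2 - Q)"
  shows "a = 1" and "c = Q^3" and "2 * b = Q^4 - Q - 2 * Q^3 + 2 * Q^2"
    and "2 * d = Q^4 - Q - 2 * Q^3 + 2 * Q - 2"
proof -
  define K where "K = Q^2 - Q"
  \<comment> \<open>The combination has the coefficients of (x + 1)(x - Q)(x + Q), which vanishes at
    Q, -1 and -Q and so isolates \<open>a\<close>.\<close>
  have "(K^3 + K^2 - Q^2 * K - Q^2) * a = N * K + N * K - Q^2 * N"
  proof -
    have "(K^3 + K^2 - Q^2 * K - Q^2) * a = (K^3 * a + Q^3 * b - c - Q^3 * d) + (K^2 * a + Q^2 * b + c + Q^2 * d)
        - Q^2 * (K * a + Q * b - c - Q * d) - Q^2 * (a + b + c + d)"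
      by (simp add: algebra_simps power_numeral_reduce)
    then show ?thesis using e0 e1 e2 e3 unfolding K_def[symmetric] by simp
  qed
  also have "\<dots> = K^3 + K^2 - Q^2 * K - Q^2"
    unfolding N K_def by (simp add: algebra_simps power_numeral_reduce)
  finally have "(K^3 + K^2 - Q^2 * K - Q^2) * (a - 1) = 0" by (simp add: algebra_simps)
  moreover have "K^3 + K^2 - Q^2 * K - Q^2 \<noteq> 0"
  proof -
    have "K - Q = Q * (Q - 2)" by (simp add: K_def algebra_simps power2_eq_square)
    then have "K - Q > 0" using Q by simp
    then have "(K + 1) * (K - Q) * (K + Q) \<noteq> 0" using Q by simp
    then show ?thesis by (simp add: algebra_simps power_numeral_reduce)
  qed
  ultimately show a: "a = 1" by simp
  \<comment> \<open>Weighting by Q^2 - x^2 eliminates \<open>b\<close> and \<open>d\<close>.\<close>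
  have "(Q^2 - 1) * c = N * Q^2 - N * K + K^2 - Q^2"
  proof -
    have "(Q^2 - 1) * c = Q^2 * (a + b + c + d) - (K^2 * a + Q^2 * b + c + Q^2 * d) + (K^2 - Q^2) * a"
      by (simp add: algebra_simps)
    then show ?thesis using e0 e2 unfolding K_def[symmetric] a by (simp add: mult.commute)
  qed
  also have "\<dots> = (Q^2 - 1) * Q^3"
    unfolding N K_def by (simp add: algebra_simps power_numeral_reduce)
  finally show c: "c = Q^3" using Q by (auto simp: power2_eq_1_iff)
  have "Q * (b - d - (Q^2 - Q + 1)) = 0"
    using e1 unfolding a c by (simp add: algebra_simps power_numeral_reduce)
  then have bd: "b - d = Q^2 - Q + 1" using Q by simp
  have "2 * b = N - 1 - Q^3 + (b - d)" using e0 unfolding a c by simp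
  then show "2 * b = Q^4 - Q - 2 * Q^3 + 2 * Q^2" unfolding bd N by simp
  have "2 * d = N - 1 - Q^3 - (b - d)" using e0 unfolding a c by simp
  then show "2 * d = Q^4 - Q - 2 * Q^3 + 2 * Q - 2" unfolding bd N by simp
qed

section \<open>Eigenvalues and multiplicities of the unitary graph\<close>

context unitary_graph_gt2
begin

abbreviation A :: "real mat" where "A \<equiv> adj_matrix n E"
abbreviation Ac :: "complex mat" where "Ac \<equiv> map_mat complex_of_real A"

lemma A_carrier: "A \<in> carrier_mat n n"
  by (simp add: adj_matrix_def)

lemma A_entry: "i < n \<Longrightarrow> j < n \<Longrightarrow> A $$ (i, j) = a i j"
  by (simp add: adj_matrix_def a_def)

lemma A2_entry: "i < n \<Longrightarrow> j < n \<Longrightarrow> (A * A) $$ (i, j) = m2 i j"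
  by (simp add: index_mult_mat_sum[OF A_carrier A_carrier] A_entry m2_def)

text \<open>With s the coordinate sum of an eigenvector v, the cubic relation gives (x + 1)(x - q)(x
  + q) v_i = (q^2 - 2q) s, and constant column sums give x s = k s. Either x = k, or s = 0 and a
  nonzero coordinate cancels.\<close>

lemma eigenvalue_cases:
  assumes "eigenvalue Ac x"
  shows "x \<in> complex_of_real ` {k, real q, -1, - real q}"
proof -
  obtain v where v: "v \<in> carrier_vec n" "v \<noteq> 0\<^sub>v n" "Ac *\<^sub>v v = x \<cdot>\<^sub>v v"
    using assms A_carrier by (auto simp: eigenvalue_def eigenvector_def)
  obtain i where i: "i < n" "v $ i \<noteq> 0"
    using v by (metis carrier_vecD eq_vecI index_zero_vec)
  let ?a = "\<lambda>i j. complex_of_real (a i j)" and ?m = "\<lambda>i j. complex_of_real (m2 i j)"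
  define s where "s = (\<Sum>l<n. v $ l)"
  have ev: "(\<Sum>l<n. ?a i l * v $ l) = x * v $ i" if "i < n" for i
  proof -
    have "(Ac *\<^sub>v v) $ i = (\<Sum>l<n. ?a i l * v $ l)"
      using that v(1) A_carrier by (auto simp: scalar_prod_def A_entry atLeast0LessThan intro!: sum.cong)
    then show ?thesis using v that by simp
  qed
  have ev2: "(\<Sum>l<n. ?m i l * v $ l) = x^2 * v $ i" if "i < n" for i
  proof -
    have "(\<Sum>l<n. ?m i l * v $ l) = (\<Sum>l<n. \<Sum>h<n. ?a i h * (?a h l * v $ l))"
      by (simp add: m2_def sum_distrib_right mult.assoc)
    also have "\<dots> = (\<Sum>h<n. \<Sum>l<n. ?a i h * (?a h l * v $ l))" by (rule sum.swap)
    also have "\<dots> = (\<Sum>h<n. x * (?a i h * v $ h))"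
      by (intro sum.cong) (auto simp: sum_distrib_left[symmetric] ev)
    finally show ?thesis using ev[OF that] by (simp add: sum_distrib_left[symmetric] power2_eq_square)
  qed
  have "(\<Sum>l<n. complex_of_real (\<Sum>h<n. a i h * m2 h l) * v $ l) = x^3 * v $ i"
  proof -
    have "(\<Sum>l<n. complex_of_real (\<Sum>h<n. a i h * m2 h l) * v $ l) =
        (\<Sum>l<n. \<Sum>h<n. ?a i h * (?m h l * v $ l))"
      by (simp add: sum_distrib_right mult.assoc)
    also have "\<dots> = (\<Sum>h<n. \<Sum>l<n. ?a i h * (?m h l * v $ l))" by (rule sum.swap)
    also have "\<dots> = (\<Sum>h<n. x^2 * (?a i h * v $ h))"
      by (intro sum.cong) (auto simp: sum_distrib_left[symmetric] ev2)
    finally show ?thesis using ev[OF i(1)] by (simp add: sum_distrib_left[symmetric] power_numeral_reduce)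
  qed
  moreover have "complex_of_real (\<Sum>h<n. a i h * m2 h l) * v $ l =
      of_nat q^2 * (?a i l * v $ l) + of_nat q^2 * (of_bool (i = l) * v $ l) +
      (of_nat q^2 - 2 * of_nat q) * v $ l - ?m i l * v $ l" if "l < n" for l
    unfolding cubic_relation[OF i(1) that] by (simp add: algebra_simps of_bool_def)
  moreover have "(\<Sum>l<n. of_bool (i = l) * v $ l) = v $ i"
    using i(1) by (simp add: of_bool_def if_distrib[of "\<lambda>x. x * _"] cong: if_cong)
  ultimately have cub: "x^3 * v $ i = of_nat q^2 * (x * v $ i) + of_nat q^2 * v $ i +
      (of_nat q^2 - 2 * of_nat q) * s - x^2 * v $ i"
    by (simp add: sum.distrib sum_subtractf sum_distrib_left[symmetric] ev[OF i(1)] ev2[OF i(1)] s_def)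
  have "x * s = (\<Sum>h<n. \<Sum>l<n. ?a h l * v $ l)" by (simp add: s_def sum_distrib_left ev)
  also have "\<dots> = (\<Sum>l<n. \<Sum>h<n. ?a l h * v $ l)"
    by (subst sum.swap) (simp add: a_sym)
  also have "\<dots> = (\<Sum>l<n. complex_of_real (\<Sum>h<n. a l h) * v $ l)" by (simp add: sum_distrib_right)
  also have "\<dots> = complex_of_real k * s" by (simp add: sum_a s_def sum_distrib_left del: of_real_sum)
  finally have "x = complex_of_real k \<or> s = 0" by auto
  moreover have "x = -1 \<or> x = of_nat q \<or> x = - of_nat q" if "s = 0"
  proof -
    have "(x + 1) * (x - of_nat q) * (x + of_nat q) * v $ i =
        x^3 * v $ i - (of_nat q^2 * (x * v $ i) + of_nat q^2 * v $ i - x^2 * v $ i)"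
      by (simp add: algebra_simps power_numeral_reduce)
    also have "\<dots> = 0" using cub that by simp
    finally show ?thesis using i(2) by (auto simp: eq_neg_iff_add_eq_0)
  qed
  ultimately show ?thesis by auto
qed

lemma mtrace_A:
  "mtrace (Ac ^\<^sub>m 1) = 0" "mtrace (Ac ^\<^sub>m 2) = complex_of_real (real n * k)"
  "mtrace (Ac ^\<^sub>m 3) = complex_of_real (real n * k)"
proof -
  have hom: "Ac ^\<^sub>m m = map_mat complex_of_real (A ^\<^sub>m m)" for m
    by (rule of_real_hom.mat_hom_pow[OF A_carrier, symmetric])
  have tr: "mtrace (Ac ^\<^sub>m m) = complex_of_real (\<Sum>i<n. (A ^\<^sub>m m) $$ (i, i))" for m
    unfolding hom mtrace_def using carrier_matD[OF pow_carrier_mat[OF A_carrier, of m]]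
      carrier_matD[OF A_carrier] by simp
  have p1: "A ^\<^sub>m 1 = A" and p2: "A ^\<^sub>m 2 = A * A" and p3: "A ^\<^sub>m 3 = A * (A * A)"
    using A_carrier by (simp_all add: numeral_2_eq_2 numeral_3_eq_3)
  show "mtrace (Ac ^\<^sub>m 1) = 0" unfolding tr p1 by (simp add: A_entry a_def E_irrefl)
  show "mtrace (Ac ^\<^sub>m 2) = complex_of_real (real n * k)"
    unfolding tr p2 by (simp add: A2_entry m2_diag)
  have "(A * (A * A)) $$ (i, i) = k" if i: "i < n" for i
  proof -
    have "(A * (A * A)) $$ (i, i) = (\<Sum>l<n. a i l * m2 l i)"
      using i A_carrier by (subst index_mult_mat_sum[of _ n]) (auto simp: A_entry A2_entry simp del: index_mult_mat(1))
    then show ?thesis unfolding cubic_relation[OF i i] using i by (simp add: m2_diag a_def E_irrefl)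
  qed
  then show "mtrace (Ac ^\<^sub>m 3) = complex_of_real (real n * k)" unfolding tr p3 by simp
qed

theorem spectrum:
  "char_poly A = [:- real (q * (q - 1)), 1:] ^ 1 * [:- real q, 1:] ^ ((q^4 - q) div 2 - q^3 + q^2) *
    [:1, 1:] ^ (q^3) * [:real q, 1:] ^ ((q^4 - q) div 2 - q^3 + q - 1)"
proof -
  obtain d where cp: "char_poly Ac = (\<Prod>i<n. [:- d i, 1:])"
    and tr: "\<And>m. mtrace (Ac ^\<^sub>m m) = (\<Sum>i<n. d i ^ m)"
    and ev: "\<And>i. i < n \<Longrightarrow> eigenvalue Ac (d i)"
    using complex_mat_eigenvalues[of Ac n] A_carrier by (metis map_carrier_mat)
  define L where "L = complex_of_real ` {k, real q, -1, - real q}"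
  have dL: "d i \<in> L" if "i < n" for i using eigenvalue_cases[OF ev[OF that]] by (simp add: L_def)
  define mu where "mu x = card {i. i < n \<and> d i = complex_of_real x}" for x
  have k1: "k = real q * (real q - 1)" by (simp add: power2_eq_square algebra_simps)
  \<comment> \<open>This keeps the four values distinct, so that sums and products over the set
    split into four terms.\<close>
  have kq: "k > real q" unfolding k1 using q_gt2 by simp
  have inj: "inj_on complex_of_real S" for S by (auto intro: inj_onI)
  have sum: "(\<Sum>i<n. d i ^ m) = complex_of_real (\<Sum>x\<in>{k, real q, -1, - real q}. real (mu x) * x ^ m)" for m
  proof -
    have "(\<Sum>i<n. d i ^ m) = (\<Sum>x\<in>L. of_nat (card {i. i < n \<and> d i = x}) * x ^ m)"
      by (rule sum_over_values) (use dL in \<open>auto simp: L_def\<close>)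
    then show ?thesis unfolding L_def by (subst (asm) sum.reindex[OF inj]) (simp add: mu_def o_def)
  qed
  have sum4: "(\<Sum>x\<in>{k, real q, -1, - real q}. f x) = f k + f (real q) + f (-1) + f (- real q)" for f :: "real \<Rightarrow> real"
    using kq q_gt2 by (simp add: add.assoc)
  have P: "(\<Sum>x\<in>{k, real q, -1, - real q}. real (mu x) * x ^ m) = t"
    if "mtrace (Ac ^\<^sub>m m) = complex_of_real t" for m t
    using that unfolding tr sum by (simp only: of_real_eq_iff)
  have e0: "real (mu k) + real (mu (real q)) + real (mu (-1)) + real (mu (- real q)) = real n"
    using P[of 0 "real n"] unfolding tr sum4 by simp
  have e1: "k * real (mu k) + real q * real (mu (real q)) - real (mu (-1)) - real q * real (mu (- real q)) = 0"
    using P[of 1 0] mtrace_A(1) unfolding sum4 by (simp add: mult.commute)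
  have e2: "k^2 * real (mu k) + real q^2 * real (mu (real q)) + real (mu (-1)) + real q^2 * real (mu (- real q)) = real n * k"
    using P[of 2 "real n * k"] mtrace_A(2) unfolding sum4 by (simp add: mult.commute)
  have e3: "k^3 * real (mu k) + real q^3 * real (mu (real q)) - real (mu (-1)) - real q^3 * real (mu (- real q)) = real n * k"
    using P[of 3 "real n * k"] mtrace_A(3) unfolding sum4 by (simp add: mult.commute)
  note mults = multiplicities[OF _ real_order e0 e1 e2 e3]
  have Q: "real q > 2" using q_gt2 by simp
  have q3: "3 * q^3 \<le> q^4" using q_gt2 by (simp add: power_numeral_reduce)
  have qq: "q \<le> q^3" using q_gt2 by (simp add: power_numeral_reduce)
  have m1: "mu k = 1" using mults(1)[OF Q] by simp
  have m3: "mu (-1) = q^3" using mults(2)[OF Q] by (simp flip: of_nat_power)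
  \<comment> \<open>The equation is free of subtraction and division, so it descends to the
    naturals, where it also shows that q^4 - q is even and \<open>div 2\<close> exact.\<close>
  have "real (2 * mu (real q) + q + 2 * q^3) = real (q^4 + 2 * q^2)" using mults(3)[OF Q] by simp
  then have b: "2 * mu (real q) + q + 2 * q^3 = q^4 + 2 * q^2" by (simp only: of_nat_eq_iff)
  then have m2: "mu (real q) = (q^4 - q) div 2 - q^3 + q^2" using q3 qq by linarith
  have "real (2 * mu (- real q) + 2 * q^3 + 2) = real (q^4 + q)" using mults(4)[OF Q] by simp
  then have "2 * mu (- real q) + 2 * q^3 + 2 = q^4 + q" by (simp only: of_nat_eq_iff)
  then have m4: "mu (- real q) = (q^4 - q) div 2 - q^3 + q - 1" using q3 qq q_gt2 by linarith
  interpret hp: map_poly_inj_idom_hom complex_of_real ..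
  have "map_poly complex_of_real (char_poly A) = char_poly Ac"
    by (rule of_real_hom.char_poly_hom[OF A_carrier, symmetric])
  also have "\<dots> = (\<Prod>x\<in>L. [:- x, 1:] ^ card {i. i < n \<and> d i = x})"
    unfolding cp by (rule prod_over_values) (use dL in \<open>auto simp: L_def\<close>)
  also have "\<dots> = (\<Prod>x\<in>{k, real q, -1, - real q}. [:- complex_of_real x, 1:] ^ mu x)"
    unfolding L_def by (subst prod.reindex[OF inj]) (simp add: mu_def o_def)
  also have "\<dots> = map_poly complex_of_real (\<Prod>x\<in>{k, real q, -1, - real q}. [:- x, 1:] ^ mu x)"
    by (simp add: hp.hom_prod hp.hom_power)
  finally have "char_poly A = (\<Prod>x\<in>{k, real q, -1, - real q}. [:- x, 1:] ^ mu x)"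
    by (simp only: hp.eq_iff)
  also have "\<dots> = [:- k, 1:] ^ mu k * [:- real q, 1:] ^ mu (real q) * [:1, 1:] ^ mu (-1) * [:real q, 1:] ^ mu (- real q)"
    using kq q_gt2 by (simp add: mult.assoc)
  also have "\<dots> = [:- k, 1:] ^ 1 * [:- real q, 1:] ^ ((q^4 - q) div 2 - q^3 + q^2) *
      [:1, 1:] ^ (q^3) * [:real q, 1:] ^ ((q^4 - q) div 2 - q^3 + q - 1)"
    by (simp only: m1 m2 m3 m4)
  also have "k = real (q * (q - 1))" using q_gt2 by (simp add: k1 of_nat_diff)
  finally show ?thesis .
qed

end

section \<open>The strongly Deza graph\<close>

theorem theorem10:
  fixes q :: nat
  assumes "primepow q" and "q > 2"
  shows "\<exists>E. strongly_deza (q^2 * (q^2 - q + 1)) E (q * (q - 1)) 1 0 \<and>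
     char_poly (adj_matrix (q^2 * (q^2 - q + 1)) E) =
       [:- real (q * (q - 1)), 1:] ^ 1 *
       [:- real q, 1:] ^ ((q^4 - q) div 2 - q^3 + q^2) *
       [:1, 1:] ^ (q^3) *
       [:real q, 1:] ^ ((q^4 - q) div 2 - q^3 + q - 1) \<and>
     srg (q^2 * (q^2 - q + 1)) (childA (q^2 * (q^2 - q + 1)) E 1 0)
         ((q - 1) * (q + 1)^2) (2 * q^2 - 2) ((q + 1)^2)"
proof -
  obtain n E where "unitary_graph n E q"
    using unitary_graph_exists[OF assms(1)] by blast
  then interpret unitary_graph_gt2 n E q
    using assms(2) by (simp add: unitary_graph_gt2_def unitary_graph_gt2_axioms_def)
  have "q \<le> q^2" using assms(2) by (simp add: power2_eq_square)
  \<comment> \<open>Writing q^2 - q as \<open>r\<close> removes the truncated subtraction from the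
    vertex count.\<close>
  then obtain r where r: "q^2 = q + r" using le_Suc_ex by blast
  then have "q^2 * (q^2 - q + 1) + q^3 = q^2 * (r + 1) + q^3" by simp
  also have "\<dots> = q^2 * (q + r) + q^2" by (simp add: algebra_simps power_numeral_reduce)
  also have "\<dots> = n + q^3" unfolding order r[symmetric] by (simp add: power_numeral_reduce)
  finally have "q^2 * (q^2 - q + 1) = n" by simp
  then show ?thesis using strongly_deza spectrum srg_childA by metis
qed

end
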